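(* Let $G$ be a finite connected graph, and consider the hat guessing game on $G$ with three colors. The sages lose on $G$ (i.e. they have no winning strategy) if and only if either $G$ is a tree, or $G$ contains exactly one cycle and this cycle has length $n$ with $n\geq 5$ and $n$ not divisible by $3$.
   Context: Hat guessing game: $G$ is a finite simple undirected graph; a sage sits at each vertex. The set of hat colors is $H=\{0,1,2\}$. A hat placement is a function $C\colon V(G)\to H$. Each sage sees exactly the hats of his neighbours in $G$ (not his own) and, without communication, simultaneously guesses the color of his own hat. A (collective, deterministic) strategy is a family of functions $f_v$, one for each vertex $v$, where $f_v$ maps the tuple of colors of the neighbours of $v$ to a color in $H$; sage $v$ guesses correctly for placement $C$ if $f_v(C(u_1),\dots,C(u_k))=C(v)$, where $u_1,\dots,u_k$ are the neighbours of $v$. A strategy is winning if for every hat placement at least one sage guesses correctly. The sages win on $G$ if a winning strategy exists, and lose otherwise. *)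

theory Defs
  imports "Graph_Theory.Digraph_Component" "HOL-Library.FuncSet"
begin

text \<open>
  A finite simple undirected graph is a \<^locale>\<open>pair_graph\<close>: a finite vertex set with a finite,
  symmetric and irreflexive adjacency relation.
\<close>

section \<open>Cycles and trees\<close>

text \<open>
  In a symmetric digraph every edge yields a directed cycle \<open>(u,v), (v,u)\<close>, which is not a cycle
  of the undirected graph; cycles of a simple graph have length at least 3. For the same reason
  the library predicate \<^const>\<open>tree\<close> fails on symmetric digraphs with at least one edge.
\<close>

definition graph_cycle :: "'a pair_pre_digraph \<Rightarrow> ('a \<times> 'a) list \<Rightarrow> bool" where
  "graph_cycle G p \<longleftrightarrow> pre_digraph.cycle (with_proj G) p \<and> 3 \<le> length p"

text \<open>
  The edge set identifies a cycle as a subgraph: lists that differ only in starting point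
  and orientation have the same edges.
\<close>

definition cycle_edges :: "('a \<times> 'a) list \<Rightarrow> 'a set set" where
  "cycle_edges p = (\<lambda>(u, v). {u, v}) ` set p"

definition graph_tree :: "'a pair_pre_digraph \<Rightarrow> bool" where
  "graph_tree G \<longleftrightarrow> Digraph_Component.connected (with_proj G) \<and> (\<nexists>p. graph_cycle G p)"

definition has_unique_cycle_of_length :: "'a pair_pre_digraph \<Rightarrow> nat \<Rightarrow> bool" where
  "has_unique_cycle_of_length G n \<longleftrightarrow>
     (\<exists>p. graph_cycle G p \<and> length p = n \<and>
          (\<forall>q. graph_cycle G q \<longrightarrow> cycle_edges q = cycle_edges p))"

section \<open>The hat guessing game\<close>

definition neighbours :: "'a pair_pre_digraph \<Rightarrow> 'a \<Rightarrow> 'a set" where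
  "neighbours G v = {u. (v, u) \<in> parcs G}"

definition hat_colors :: "nat set" where
  "hat_colors = {0, 1, 2}"

definition hat_placements :: "'a pair_pre_digraph \<Rightarrow> ('a \<Rightarrow> nat) set" where
  "hat_placements G = pverts G \<rightarrow>\<^sub>E hat_colors"

text \<open>
  The argument of \<open>f v\<close> is the tuple of colors of the neighbours of \<open>v\<close>, encoded as an extensional
  function on the set of neighbours.
\<close>

definition strategy :: "'a pair_pre_digraph \<Rightarrow> ('a \<Rightarrow> ('a \<Rightarrow> nat) \<Rightarrow> nat) \<Rightarrow> bool" where
  "strategy G f \<longleftrightarrow> (\<forall>v \<in> pverts G. f v \<in> (neighbours G v \<rightarrow>\<^sub>E hat_colors) \<rightarrow> hat_colors)"

definition guesses_correctly ::
  "'a pair_pre_digraph \<Rightarrow> ('a \<Rightarrow> ('a \<Rightarrow> nat) \<Rightarrow> nat) \<Rightarrow> ('a \<Rightarrow> nat) \<Rightarrow> 'a \<Rightarrow> bool" where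
  "guesses_correctly G f C v \<longleftrightarrow> f v (restrict C (neighbours G v)) = C v"

definition winning_strategy ::
  "'a pair_pre_digraph \<Rightarrow> ('a \<Rightarrow> ('a \<Rightarrow> nat) \<Rightarrow> nat) \<Rightarrow> bool" where
  "winning_strategy G f \<longleftrightarrow>
     strategy G f \<and> (\<forall>C \<in> hat_placements G. \<exists>v \<in> pverts G. guesses_correctly G f C v)"

definition sages_win :: "'a pair_pre_digraph \<Rightarrow> bool" where
  "sages_win G \<longleftrightarrow> (\<exists>f. winning_strategy G f)"

abbreviation sages_lose :: "'a pair_pre_digraph \<Rightarrow> bool" where
  "sages_lose G \<equiv> \<not> sages_win G"

end

theory Submission
  imports Defs
begin

text \<open>
  A family of guessing functions on a set \<open>D\<close> of sages \<^emph>\<open>forces\<close> a property if every placement on which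
  all sages of \<open>D\<close> are wrong has it; to win is to force \<open>False\<close>, and forced properties of disjoint sets
  of sages can be combined.

  \<^emph>\<open>Losing.\<close> A sage with at most one neighbour can be deleted: his neighbour takes the majority of his
  guesses over the three hats of the deleted sage. So a winning graph has a winning induced subgraph of
  minimum degree 2, hence a cycle, and if the cycle is unique then that subgraph is the cycle. On a cycle
  with \<open>n \<ge> 5\<close>, call for two consecutive hats \<open>(p, a)\<close> the number of next hats for which the holder of
  \<open>a\<close> guesses right the forward kills, and define the backward kills symmetrically. Two continuations of
  a partial wrong placement always produce two continuations one step later, so forward and backward
  kills of a state of an edge add up to at least 2 for a winning strategy; as they sum to 18 over the nine
  states of an edge, equality holds throughout. This rigidity forces the states of each edge to split
  into three levels (0, 1 or 2 forward kills), each of them a bijection between the hats of the two ends,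
  such that a transition between equal levels is never a right guess. Some level closes up to a wrong
  placement of the whole cycle unless 3 divides \<open>n\<close>.

  \<^emph>\<open>Winning.\<close> Three or more sages on a path from \<open>u\<close> to \<open>w\<close> can force the following: either \<open>u\<close> reads off
  one bit of his own hat from the first of them, or \<open>w\<close> reads off (and knows that he does) one bit of his
  own hat from the last of them; the bits may be chosen freely. If \<open>u = w\<close>, then \<open>u\<close> simply learns a bit of
  his own hat. Two cycles through one vertex therefore tell it its hat, a path between disjoint cycles
  transports the missing bit, and three paths between \<open>u\<close> and \<open>w\<close> suffice unless two of them are so short
  that they form a cycle of length 4 or divisible by 3, on which the sages win anyway. Two different
  cycles in a connected graph always contain one of these three configurations.
\<close>

section \<open>Forcing\<close>

datatype hat = H0 | H1 | H2

text \<open>A guess \<open>F v\<close> takes the whole placement; that only visible hats matter is a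
  congruence condition. The neighbourhood map \<open>N\<close> is a parameter, so induced subgraphs
  are covered by cutting \<open>N v\<close> down to a vertex set.\<close>

definition forces :: "('a \<Rightarrow> 'a set) \<Rightarrow> 'a set \<Rightarrow> (('a \<Rightarrow> hat) \<Rightarrow> bool) \<Rightarrow> bool" where
  "forces N D P \<longleftrightarrow> (\<exists>F. (\<forall>v\<in>D. \<forall>C C'. (\<forall>u\<in>N v. C u = C' u) \<longrightarrow> F v C = F v C') \<and>
     (\<forall>C. (\<forall>v\<in>D. F v C \<noteq> C v) \<longrightarrow> P C))"

lemma forcesI:
  fixes N :: "'a \<Rightarrow> 'a set"
  assumes "\<And>v C C'. v \<in> D \<Longrightarrow> (\<And>u. u \<in> N v \<Longrightarrow> C u = C' u) \<Longrightarrow> F v C = F v C'"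
    and "\<And>C. (\<And>v. v \<in> D \<Longrightarrow> F v C \<noteq> C v) \<Longrightarrow> P C"
  shows "forces N D P"
  unfolding forces_def
proof (intro exI[of _ F] conjI ballI allI impI)
  fix v and C C' :: "'a \<Rightarrow> hat" assume "v \<in> D" "\<forall>u\<in>N v. C u = C' u"
  then show "F v C = F v C'" by (intro assms(1)) auto
next
  fix C :: "'a \<Rightarrow> hat" assume "\<forall>v\<in>D. F v C \<noteq> C v"
  then show "P C" by (intro assms(2)) auto
qed

lemma forcesE:
  assumes "forces N D P"
  obtains F where "\<forall>v\<in>D. \<forall>C C'. (\<forall>u\<in>N v. C u = C' u) \<longrightarrow> F v C = F v C'"
    and "\<forall>C. (\<forall>v\<in>D. F v C \<noteq> C v) \<longrightarrow> P C"
proof -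
  from assms obtain F where F: "(\<forall>v\<in>D. \<forall>C C'. (\<forall>u\<in>N v. C u = C' u) \<longrightarrow> F v C = F v C') \<and>
     (\<forall>C. (\<forall>v\<in>D. F v C \<noteq> C v) \<longrightarrow> P C)"
    unfolding forces_def ..
  show thesis by (rule that[OF conjunct1[OF F] conjunct2[OF F]])
qed

lemma forces_family:
  fixes t :: "'i \<Rightarrow> 'a"
  assumes inj: "inj_on t I"
    and local: "\<And>i C C'. i \<in> I \<Longrightarrow> (\<And>u. u \<in> N (t i) \<Longrightarrow> C u = C' u) \<Longrightarrow> g i C = g i C'"
  shows "forces N (t ` I) (\<lambda>C. \<forall>i\<in>I. g i C \<noteq> C (t i))"
proof (rule forcesI[where F = "\<lambda>v. g (inv_into I t v)"])
  fix v and C C' :: "'a \<Rightarrow> hat" assume v: "v \<in> t ` I" and "\<And>u. u \<in> N v \<Longrightarrow> C u = C' u"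
  moreover have "inv_into I t v \<in> I" "t (inv_into I t v) = v"
    using v by (auto intro: inv_into_into f_inv_into_f)
  ultimately show "g (inv_into I t v) C = g (inv_into I t v) C'"
    by (intro local) auto
next
  fix C :: "'a \<Rightarrow> hat" assume *: "\<And>v. v \<in> t ` I \<Longrightarrow> g (inv_into I t v) C \<noteq> C v"
  show "\<forall>i\<in>I. g i C \<noteq> C (t i)"
    using *[OF imageI] inv_into_f_f[OF inj] by simp
qed

lemma forces_vertex:
  fixes N :: "'a \<Rightarrow> 'a set"
  assumes "\<And>C C'. (\<And>u. u \<in> N v \<Longrightarrow> C u = C' u) \<Longrightarrow> g C = g C'"
  shows "forces N {v} (\<lambda>C. g C \<noteq> C v)"
proof (rule forcesI[where F = "\<lambda>_. g"])
  fix v' and C C' :: "'a \<Rightarrow> hat" assume "v' \<in> {v}" "\<And>u. u \<in> N v' \<Longrightarrow> C u = C' u"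
  then show "g C = g C'" by (intro assms) simp
qed simp

text \<open>Disjointness leaves every sage with a single guessing function, so the two families can
  be merged.\<close>

lemma forces_Un:
  fixes N :: "'a \<Rightarrow> 'a set"
  assumes "forces N D P" "forces N E Q" "D \<inter> E = {}"
  shows "forces N (D \<union> E) (\<lambda>C. P C \<and> Q C)"
proof -
  obtain F where F: "\<forall>v\<in>D. \<forall>C C'. (\<forall>u\<in>N v. C u = C' u) \<longrightarrow> F v C = F v C'"
      "\<forall>C. (\<forall>v\<in>D. F v C \<noteq> C v) \<longrightarrow> P C"
    using assms(1) by (rule forcesE)
  obtain F' where F': "\<forall>v\<in>E. \<forall>C C'. (\<forall>u\<in>N v. C u = C' u) \<longrightarrow> F' v C = F' v C'"
      "\<forall>C. (\<forall>v\<in>E. F' v C \<noteq> C v) \<longrightarrow> Q C"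
    using assms(2) by (rule forcesE)
  show ?thesis
  proof (rule forcesI[where F = "\<lambda>v. if v \<in> D then F v else F' v"])
    fix v and C C' :: "'a \<Rightarrow> hat" assume "v \<in> D \<union> E" "\<And>u. u \<in> N v \<Longrightarrow> C u = C' u"
    then show "(if v \<in> D then F v else F' v) C = (if v \<in> D then F v else F' v) C'"
      using F(1)[rule_format, of v C C'] F'(1)[rule_format, of v C C'] by auto
  next
    fix C :: "'a \<Rightarrow> hat"
    assume *: "\<And>v. v \<in> D \<union> E \<Longrightarrow> (if v \<in> D then F v else F' v) C \<noteq> C v"
    have "F v C \<noteq> C v" if "v \<in> D" for v
      using *[of v] that by simp
    moreover have "F' v C \<noteq> C v" if "v \<in> E" for v
    proof -
      have "v \<notin> D" using that assms(3) by blast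
      then show ?thesis using *[of v] that by simp
    qed
    ultimately show "P C \<and> Q C" using F(2) F'(2) by simp
  qed
qed

lemma forces_mono:
  fixes N :: "'a \<Rightarrow> 'a set"
  assumes "forces N D P" "D \<subseteq> D'" "\<And>C. P C \<Longrightarrow> Q C"
  shows "forces N D' Q"
proof -
  obtain F where F: "\<forall>v\<in>D. \<forall>C C'. (\<forall>u\<in>N v. C u = C' u) \<longrightarrow> F v C = F v C'"
      "\<forall>C. (\<forall>v\<in>D. F v C \<noteq> C v) \<longrightarrow> P C"
    using assms(1) by (rule forcesE)
  show ?thesis
  \<comment> \<open>The added sages guess a constant.\<close>
  proof (rule forcesI[where F = "\<lambda>v. if v \<in> D then F v else (\<lambda>_. H0)"])
    fix v and C C' :: "'a \<Rightarrow> hat" assume "v \<in> D'" "\<And>u. u \<in> N v \<Longrightarrow> C u = C' u"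
    then show "(if v \<in> D then F v else (\<lambda>_. H0)) C = (if v \<in> D then F v else (\<lambda>_. H0)) C'"
      using F(1)[rule_format, of v C C'] by auto
  next
    fix C :: "'a \<Rightarrow> hat"
    assume *: "\<And>v. v \<in> D' \<Longrightarrow> (if v \<in> D then F v else (\<lambda>_. H0)) C \<noteq> C v"
    have "F v C \<noteq> C v" if "v \<in> D" for v
      using *[of v] that assms(2) by auto
    then show "Q C" using F(2) assms(3) by simp
  qed
qed

section \<open>Translation between numeric colors and the type \<open>hat\<close>\<close>

fun hat_nat :: "hat \<Rightarrow> nat" where
  "hat_nat H0 = 0" | "hat_nat H1 = 1" | "hat_nat H2 = 2"

definition nat_hat :: "nat \<Rightarrow> hat" where
  "nat_hat n = (if n = 0 then H0 else if n = 1 then H1 else H2)"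

lemma nat_hat_nat [simp]: "nat_hat (hat_nat h) = h"
  by (cases h) (auto simp: nat_hat_def)

lemma hat_nat_hat: "n \<in> hat_colors \<Longrightarrow> hat_nat (nat_hat n) = n"
  by (auto simp: nat_hat_def hat_colors_def)

lemma hat_nat_in [simp]: "hat_nat h \<in> hat_colors"
  by (cases h) (auto simp: hat_colors_def)

text \<open>Guesses are conjugated by \<open>hat_nat\<close> and \<open>nat_hat\<close>; restricting
  a placement to the neighbours does not affect a local guess.\<close>

lemma sages_win_iff_forces:
  fixes G :: "'a pair_pre_digraph"
  assumes "pair_graph G"
  shows "sages_win G \<longleftrightarrow> forces (neighbours G) (pverts G) (\<lambda>_. False)"
proof
  interpret pair_graph G by fact
  have nb: "neighbours G v \<subseteq> pverts G" for v
    by (auto simp: neighbours_def dest: in_arcsD2)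
  assume "sages_win G"
  then obtain f where f: "\<forall>C \<in> hat_placements G. \<exists>v \<in> pverts G. guesses_correctly G f C v"
    unfolding sages_win_def winning_strategy_def by blast
  define F where "F v C = nat_hat (f v (restrict (hat_nat \<circ> C) (neighbours G v)))" for v C
  show "forces (neighbours G) (pverts G) (\<lambda>_. False)"
  proof (rule forcesI[where F = F])
    fix v and C C' :: "'a \<Rightarrow> hat" assume "\<And>u. u \<in> neighbours G v \<Longrightarrow> C u = C' u"
    then have "restrict (hat_nat \<circ> C) (neighbours G v) = restrict (hat_nat \<circ> C') (neighbours G v)"
      by (auto intro!: restrict_ext)
    then show "F v C = F v C'" by (simp add: F_def)
  next
    fix C :: "'a \<Rightarrow> hat" assume wrong: "\<And>v. v \<in> pverts G \<Longrightarrow> F v C \<noteq> C v"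
    let ?D = "restrict (hat_nat \<circ> C) (pverts G)"
    have "?D \<in> hat_placements G" by (auto simp: hat_placements_def)
    then obtain v where v: "v \<in> pverts G" "guesses_correctly G f ?D v" using f by blast
    moreover have "restrict ?D (neighbours G v) = restrict (hat_nat \<circ> C) (neighbours G v)"
      using nb[of v] by (auto simp: restrict_def fun_eq_iff)
    ultimately have "F v C = C v"
      by (simp add: F_def guesses_correctly_def)
    with wrong v show False by blast
  qed
next
  assume *: "forces (neighbours G) (pverts G) (\<lambda>_. False)"
  obtain F :: "'a \<Rightarrow> ('a \<Rightarrow> hat) \<Rightarrow> hat" where F:
      "\<forall>v\<in>pverts G. \<forall>C C'. (\<forall>u\<in>neighbours G v. C u = C' u) \<longrightarrow> F v C = F v C'"
      "\<forall>C. (\<forall>v\<in>pverts G. F v C \<noteq> C v) \<longrightarrow> False"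
    using * by (rule forcesE)
  define f where "f v D = hat_nat (F v (nat_hat \<circ> D))" for v D
  have "strategy G f"
    by (auto simp: strategy_def f_def)
  moreover have "\<exists>v\<in>pverts G. guesses_correctly G f D v" if D: "D \<in> hat_placements G" for D
  proof -
    obtain v where v: "v \<in> pverts G" "F v (nat_hat \<circ> D) = (nat_hat \<circ> D) v"
      using F(2)[rule_format, of "nat_hat \<circ> D"] by blast
    have "F v (nat_hat \<circ> restrict D (neighbours G v)) = F v (nat_hat \<circ> D)"
      by (rule F(1)[rule_format]) (use v in auto)
    moreover have "D v \<in> hat_colors"
      using D v(1) by (auto simp: hat_placements_def)
    ultimately show ?thesis
      using v by (auto simp: guesses_correctly_def f_def hat_nat_hat intro!: bexI[of _ v])
  qed
  ultimately show "sages_win G"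
    unfolding sages_win_def winning_strategy_def by blast
qed

section \<open>Signals along paths\<close>

definition walk :: "('a \<Rightarrow> 'a set) \<Rightarrow> (nat \<Rightarrow> 'a) \<Rightarrow> nat \<Rightarrow> bool" where
  "walk N t k \<longleftrightarrow> (\<forall>i<k. t (Suc i) \<in> N (t i) \<and> t i \<in> N (t (Suc i)))"

lemma forces_walk:
  assumes "walk N t (Suc m)" "inj_on t {1..m}"
  shows "forces N (t ` {1..m}) (\<lambda>C. \<forall>i\<in>{1..m}. g i (C (t (i - 1))) (C (t (Suc i))) \<noteq> C (t i))"
proof (rule forces_family)
  fix i and C C' :: "'a \<Rightarrow> hat"
  assume i: "i \<in> {1..m}" and *: "\<And>u. u \<in> N (t i) \<Longrightarrow> C u = C' u"
  have "t (i - 1) \<in> N (t i)" "t (Suc i) \<in> N (t i)"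
    using assms(1)[unfolded walk_def, rule_format, of "i - 1"]
      assms(1)[unfolded walk_def, rule_format, of i] i by auto
  then show "g i (C (t (i - 1))) (C (t (Suc i))) = g i (C' (t (i - 1))) (C' (t (Suc i)))"
    using * by simp
qed fact

text \<open>Guess of an inner sage with left hat \<open>a\<close> and right hat \<open>c\<close>. If
  it is wrong, \<open>H1\<close> is not followed by \<open>H0\<close>; and after a left hat other
  than \<open>H1\<close>, the own hat is not \<open>H2\<close> if \<open>c = H0\<close> and not
  \<open>H1\<close> otherwise.\<close>

definition relay :: "hat \<Rightarrow> hat \<Rightarrow> hat" where
  "relay a c = (if a = H1 then H0 else if c = H0 then H2 else H1)"

text \<open>
  \<open>c\<close> and \<open>e\<close> are the hats of the first and last inner sage, \<open>b\<close> is the bit of \<open>u\<close> and \<open>v \<in> {H1, H2}\<close>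
  encodes the bit of \<open>w\<close>. Reading \<open>c = H0\<close> as \<open>b\<close> and \<open>c \<noteq> H0\<close> as \<open>\<not> b\<close>, the sage \<open>u\<close> errs only if \<open>e \<noteq> H0\<close>,
  in which case \<open>e\<close> is the element of \<open>{H1, H2}\<close> other than \<open>v\<close>.
\<close>

definition signal :: "bool \<Rightarrow> hat \<Rightarrow> hat \<Rightarrow> hat \<Rightarrow> bool" where
  "signal b c e v \<longleftrightarrow> (if b then c \<noteq> H1 \<and> (c = H2 \<longrightarrow> e \<noteq> H0) else c \<noteq> H0) \<and> e \<noteq> v"

text \<open>Wrong relays allow \<open>H1\<close> at an inner position only after another
  \<open>H1\<close>, and the first sage excludes \<open>H1\<close> at both of the first two
  positions. So positions \<open>2\<close> to \<open>m - 1\<close> avoid \<open>H1\<close>, and the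
  last sage guesses \<open>v\<close>. If \<open>b\<close> holds and the path starts with
  \<open>H2\<close>, the next hat is not \<open>H0\<close>, and this pattern repeats up to the
  end.\<close>

lemma signal_sequence:
  fixes c :: "nat \<Rightarrow> hat"
  assumes m: "3 \<le> m" and v: "v \<noteq> H0"
    and first: "(if b then if c 2 = H0 then H2 else H1 else if c 2 = H1 then H1 else H0) \<noteq> c 1"
    and mid: "\<And>i. 2 \<le> i \<Longrightarrow> i < m \<Longrightarrow> relay (c (i - 1)) (c (Suc i)) \<noteq> c i"
    and last: "(if c (m - 1) = H1 then H0 else v) \<noteq> c m"
  shows "signal b (c 1) (c m) v"
proof -
  have no10: "c i \<noteq> H0" if "c (i - 1) = H1" "2 \<le> i" "i \<le> m" for i
    using mid[of i] last that by (cases "i = m") (auto simp: relay_def)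
  have mid': "c i \<noteq> (if c (Suc i) = H0 then H2 else H1)" if "c (i - 1) \<noteq> H1" "2 \<le> i" "i < m" for i
    using mid[of i] that by (auto simp: relay_def)
  have no1: "c i \<noteq> H1" if "c (i - 1) \<noteq> H1" "2 \<le> i" "i < m" for i
    using mid'[OF that] no10[of "Suc i"] that by auto
  have not1: "c i \<noteq> H1" if "c 1 \<noteq> H1 \<or> c 2 \<noteq> H1" "2 \<le> i" "i < m" for i
    using that(2,3)
  proof (induction i rule: dec_induct)
    case base
    then show ?case using no1[of 2] that(1) m by auto
  next
    case (step i)
    then show ?case using no1[of "Suc i"] by auto
  qed
  have c12: "c 1 \<noteq> H1 \<or> c 2 \<noteq> H1"
    using first by (auto split: if_splits)
  have "c (m - 1) \<noteq> H1" using not1[OF c12, of "m - 1"] m by auto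
  then have "c m \<noteq> v" using last by auto
  moreover have "c 1 \<noteq> H0" if "\<not> b"
    using first that not1[OF c12, of 2] m by auto
  moreover have b1: "c 1 \<noteq> H1" if b
    using first that no10[of 2] m by (auto split: if_splits)
  moreover have "c m \<noteq> H0" if b "c 1 = H2"
  proof -
    have "c i = H2 \<and> c (Suc i) \<noteq> H0" if "1 \<le> i" "i < m" for i
      using that
    proof (induction i rule: dec_induct)
      case base
      then show ?case using first \<open>b\<close> \<open>c 1 = H2\<close> by (auto split: if_splits simp: numeral_2_eq_2)
    next
      case (step i)
      then have "c (Suc i) \<noteq> H0" "c i \<noteq> H1" by auto
      moreover have "c (Suc i) \<noteq> H1" using no1[of "Suc i"] step by auto
      ultimately have "c (Suc i) = H2" by (cases "c (Suc i)") auto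
      then show ?case using mid'[of "Suc i"] step by auto
    qed
    from this[of "m - 1"] m show ?thesis by simp
  qed
  ultimately show ?thesis by (auto simp: signal_def)
qed

lemma forces_signal:
  assumes "walk N t (Suc m)" "inj_on t {1..m}" "3 \<le> m" "\<And>y. v y \<noteq> H0"
  shows "forces N (t ` {1..m}) (\<lambda>C. signal (b (C (t 0))) (C (t 1)) (C (t m)) (v (C (t (Suc m)))))"
proof (rule forces_mono[OF forces_walk[OF assms(1,2), of "\<lambda>i x z.
    if i = 1 then if b x then if z = H0 then H2 else H1 else if z = H1 then H1 else H0
    else if i = m then if x = H1 then H0 else v z else relay x z"]], goal_cases)
  case (2 C)
  note * = bspec[OF 2]
  show ?case
  proof (rule signal_sequence[where c = "\<lambda>i. C (t i)"])
    show "(if b (C (t 0)) then if C (t 2) = H0 then H2 else H1 else if C (t 2) = H1 then H1 else H0)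
        \<noteq> C (t 1)"
      using *[of 1] assms(3) by (auto simp: numeral_2_eq_2 split: if_splits)
    show "relay (C (t (i - 1))) (C (t (Suc i))) \<noteq> C (t i)" if "2 \<le> i" "i < m" for i
      using *[of i] that by simp
    show "(if C (t (m - 1)) = H1 then H0 else v (C (t (Suc m)))) \<noteq> C (t m)"
      using *[of m] assms(3) by simp
  qed (use assms in auto)
qed simp

section \<open>Winning cycles\<close>

definition circuit :: "('a \<Rightarrow> 'a set) \<Rightarrow> (nat \<Rightarrow> 'a) \<Rightarrow> nat \<Rightarrow> bool" where
  "circuit N c n \<longleftrightarrow> 3 \<le> n \<and> walk N c n \<and> inj_on c {0..<n} \<and> c n = c 0"

fun rot :: "hat \<Rightarrow> hat" where
  "rot H0 = H1" | "rot H1 = H2" | "rot H2 = H0"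

lemma rot_rot_rot [simp]: "rot (rot (rot x)) = x"
  by (cases x) auto

lemma rot_neq [simp]: "rot x \<noteq> x" "x \<noteq> rot x" "rot (rot x) \<noteq> x" "x \<noteq> rot (rot x)"
  by (cases x; simp)+

lemma hat_cases_rot: obtains "y = x" | "y = rot x" | "y = rot (rot x)"
  by (cases x; cases y; simp)

lemma rot_power: "3 dvd n \<Longrightarrow> (rot ^^ n) x = x"
proof -
  have "(rot ^^ (3 * k)) x = x" for k
    by (induction k) (simp_all add: numeral_3_eq_3)
  then show "3 dvd n \<Longrightarrow> (rot ^^ n) x = x" by (auto elim!: dvdE)
qed

text \<open>
  In terms of the differences of consecutive hats, a sage using this rule is wrong iff the difference
  does not increase with respect to the order \<open>0 > 2 > 1\<close>.
\<close>

definition descent :: "hat \<Rightarrow> hat \<Rightarrow> hat" where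
  "descent a c = (if c = a then rot a else c)"

lemma descent_step:
  assumes "descent a c \<noteq> b"
  shows "b = rot a \<Longrightarrow> c = rot b"
    and "b = rot (rot a) \<Longrightarrow> c = rot (rot b) \<or> c = rot b"
    and "b \<noteq> a \<Longrightarrow> c \<noteq> b"
  using assms by (cases a; cases b; cases c; simp add: descent_def)+

text \<open>The differences of consecutive hats do not increase, and the twist makes the difference
  at \<open>n\<close> equal to that at \<open>0\<close>, so all agree. As \<open>3 dvd n\<close>,
  the sum of \<open>n\<close> equal differences vanishes, whereas the twist demands one
  rotation.\<close>

lemma descent_closed:
  fixes d :: "nat \<Rightarrow> hat"
  assumes step: "\<And>i. 1 \<le> i \<Longrightarrow> i \<le> n \<Longrightarrow> descent (d (i - 1)) (d (Suc i)) \<noteq> d i"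
    and twist: "d n = rot (d 0)" "d (Suc n) = rot (d 1)" and n: "3 dvd n"
  shows False
proof -
  have step': "descent (d i) (d (Suc (Suc i))) \<noteq> d (Suc i)" if "Suc i \<le> n" for i
    using step[of "Suc i"] that by simp
  consider "d 1 = d 0" | "d 1 = rot (d 0)" | "d 1 = rot (rot (d 0))"
    using hat_cases_rot[of "d 1" "d 0"] by blast
  then show False
  proof cases
    case 1
    have "d i = d 0 \<or> d (Suc i) \<noteq> d i" if "i \<le> n" for i
      using that
    proof (induction i)
      case (Suc i)
      then show ?case
        using descent_step(3)[OF step'[of i]] by (cases "d (Suc i) = d i") auto
    qed simp
    from this[of n] show False unfolding twist 1 by simp
  next
    case 2
    have "d (Suc i) = rot (d i)" if "i \<le> n" for i
      using that
    proof (induction i)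
      case (Suc i)
      then show ?case using descent_step(1)[OF step'[of i]] by simp
    qed (use 2 in simp)
    then have "i \<le> n \<Longrightarrow> d i = (rot ^^ i) (d 0)" for i
      by (induction i) simp_all
    from this[of n] show False using twist(1) rot_power[OF n] by simp
  next
    case 3
    have *: "d i = (rot ^^ (2 * i)) (d 0) \<and> d (Suc i) = rot (rot (d i)) \<or> d (Suc i) = rot (d i)"
      if "i \<le> n" for i
      using that
    proof (induction i)
      case (Suc i)
      then consider "d i = (rot ^^ (2 * i)) (d 0)" "d (Suc i) = rot (rot (d i))" | "d (Suc i) = rot (d i)"
        by auto
      then show ?case
      proof cases
        case 1
        then have "d (Suc i) = (rot ^^ (2 * Suc i)) (d 0)" by simp
        with descent_step(2)[OF step'[OF Suc.prems] 1(2)] show ?thesis by metis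
      next
        case 2
        then show ?thesis using descent_step(1)[OF step'[OF Suc.prems]] by metis
      qed
    qed (use 3 in simp)
    have "(rot ^^ (2 * n)) (d 0) = d 0" using n by (intro rot_power) simp
    with *[of n] twist(1) have "d (Suc n) = rot (d n)" by auto
    then show False using twist 3 by simp
  qed
qed

lemma walkD:
  assumes "walk N t k" "i < k"
  shows "t (Suc i) \<in> N (t i)" "t i \<in> N (t (Suc i))"
  using assms by (auto simp: walk_def)

lemma forces_circuit_3:
  assumes "circuit N c n" "3 dvd n"
  shows "forces N (c ` {0..<n}) (\<lambda>_. False)"
proof -
  have n: "3 \<le> n" and wk: "walk N c n" and inj: "inj_on c {0..<n}" and cn: "c n = c 0"
    using assms(1) by (auto simp: circuit_def)
  \<comment> \<open>The hats continue beyond position \<open>n\<close> with an extra rotation, which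
    supplies the twist. Sage \<open>0\<close> thus also stands at position \<open>n\<close> with a
    rotated hat; the two further rotations in his guess undo this.\<close>
  define d where "d C i = (if i < n then C (c i) else rot (C (c (i - n))))" for C :: "'a \<Rightarrow> hat" and i
  define g where "g i C = (if i = 0 then rot (rot (descent (d C (n - 1)) (d C (Suc n))))
      else descent (d C (i - 1)) (d C (Suc i)))" for i C
  have "forces N (c ` {0..<n}) (\<lambda>C. \<forall>i\<in>{0..<n}. g i C \<noteq> C (c i))"
  proof (rule forces_family[OF inj])
    fix i and C C' :: "'a \<Rightarrow> hat"
    assume i: "i \<in> {0..<n}" and *: "\<And>u. u \<in> N (c i) \<Longrightarrow> C u = C' u"
    show "g i C = g i C'"
    proof (cases "i = 0")
      case True
      have "c (n - 1) \<in> N (c 0)" "c 1 \<in> N (c 0)"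
        using walkD[OF wk, of "n - 1"] walkD[OF wk, of 0] n cn by auto
      then show ?thesis using * True n by (simp add: g_def d_def)
    next
      case False
      have "c (i - 1) \<in> N (c i)" "c (Suc i) \<in> N (c i)"
        using walkD[OF wk, of "i - 1"] walkD[OF wk, of i] False i by auto
      moreover have "Suc i < n \<or> Suc i = n" using i by auto
      ultimately show ?thesis using * False i cn by (auto simp: g_def d_def)
    qed
  qed
  then show ?thesis
  proof (rule forces_mono)
    fix C assume *: "\<forall>i\<in>{0..<n}. g i C \<noteq> C (c i)"
    show False
    proof (rule descent_closed[of n "d C", OF _ _ _ assms(2)])
      fix i assume i: "1 \<le> i" "i \<le> n"
      show "descent (d C (i - 1)) (d C (Suc i)) \<noteq> d C i"
      proof (cases "i = n")
        case True
        have "descent (d C (n - 1)) (d C (Suc n)) \<noteq> rot (C (c 0))"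
          using bspec[OF *, of 0] n by (auto simp: g_def)
        then show ?thesis using True by (simp add: d_def)
      next
        case False
        then show ?thesis using bspec[OF *, of i] i by (auto simp: g_def d_def)
      qed
    qed (use n in \<open>auto simp: d_def\<close>)
  qed simp
qed

fun hat_plus :: "hat \<Rightarrow> hat \<Rightarrow> hat" where
  "hat_plus H0 y = y" | "hat_plus H1 y = rot y" | "hat_plus H2 y = rot (rot y)"

fun hat_minus :: "hat \<Rightarrow> hat" where
  "hat_minus H0 = H0" | "hat_minus H1 = H2" | "hat_minus H2 = H1"

text \<open>The four linear guesses, like the guesses of the theta graphs below, come from a computer search.\<close>

lemma four_cycle_guess:
  "hat_plus d b = a \<or> hat_plus c (hat_minus a) = b \<or> hat_plus d (hat_minus b) = c \<or>
   hat_minus (hat_plus a c) = d"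
  by (cases a; cases b; cases c; cases d; simp)

lemma forces_circuit_4:
  assumes "circuit N c 4"
  shows "forces N (c ` {0..<4}) (\<lambda>_. False)"
proof -
  have wk: "walk N c 4" and inj: "inj_on c {0..<4}" and c4: "c 4 = c 0"
    using assms(1) by (auto simp: circuit_def)
  have nb: "c 3 \<in> N (c 0)" "c 1 \<in> N (c 0)" "c 0 \<in> N (c 1)" "c 2 \<in> N (c 1)"
      "c 1 \<in> N (c 2)" "c 3 \<in> N (c 2)" "c 2 \<in> N (c 3)" "c 0 \<in> N (c 3)"
    using walkD[OF wk, of 0] walkD[OF wk, of 1] walkD[OF wk, of 2] walkD[OF wk, of 3] c4
    by (simp_all add: eval_nat_numeral)
  define g where "g i C = (if i = 0 then hat_plus (C (c 3)) (C (c 1))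
      else if i = 1 then hat_plus (C (c 2)) (hat_minus (C (c 0)))
      else if i = 2 then hat_plus (C (c 3)) (hat_minus (C (c 1)))
      else hat_minus (hat_plus (C (c 0)) (C (c 2))))" for i :: nat and C
  have "forces N (c ` {0..<4}) (\<lambda>C. \<forall>i\<in>{0..<4}. g i C \<noteq> C (c i))"
  proof (rule forces_family[OF inj])
    fix i and C C' :: "'a \<Rightarrow> hat"
    assume "i \<in> {0..<4}" and *: "\<And>u. u \<in> N (c i) \<Longrightarrow> C u = C' u"
    then consider "i = 0" | "i = 1" | "i = 2" | "i = 3" by fastforce
    then show "g i C = g i C'"
      by cases (use * nb in \<open>simp_all add: g_def\<close>)
  qed
  then show ?thesis
  proof (rule forces_mono)
    fix C assume *: "\<forall>i\<in>{0..<4}. g i C \<noteq> C (c i)"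
    show False
      \<comment> \<open>The instantiation follows the first occurrences \<open>d\<close>,
        \<open>b\<close>, \<open>a\<close>, \<open>c\<close>; the cyclic order of the sages is
        \<open>a\<close>, \<open>b\<close>, \<open>c\<close>, \<open>d\<close>.\<close>
      using bspec[OF *, of 0] bspec[OF *, of 1] bspec[OF *, of 2] bspec[OF *, of 3]
        four_cycle_guess[of "C (c 3)" "C (c 1)" "C (c 0)" "C (c 2)"] by (auto simp: g_def)
  qed simp
qed

definition winning_length :: "nat \<Rightarrow> bool" where
  "winning_length n \<longleftrightarrow> n = 4 \<or> 3 dvd n"

lemma forces_circuit:
  assumes "circuit N c n" "winning_length n"
  shows "forces N (c ` {0..<n}) (\<lambda>_. False)"
  using assms forces_circuit_3 forces_circuit_4 by (auto simp: winning_length_def)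

text \<open>A path from \<open>c 0\<close> back to itself that signals the same bit in both directions.\<close>

lemma forces_circuit_bit:
  assumes "circuit N c n" "4 \<le> n"
  shows "forces N (c ` {1..<n})
    (\<lambda>C. (C (c 1) = H0 \<or> C (c 1) = H2 \<and> C (c (n - 1)) = H2) = b (C (c 0)))"
proof -
  define m where "m = n - 1"
  have m: "Suc m = n" "3 \<le> m" using assms(2) by (auto simp: m_def)
  \<comment> \<open>With this code for the bit at the far end, the ambiguous first hat
    \<open>H2\<close> is decided by the last hat, which is \<open>H2\<close> if the bit holds and
    another hat if not.\<close>
  have "forces N (c ` {1..m}) (\<lambda>C. signal (b (C (c 0))) (C (c 1)) (C (c m))
      (if b (C (c (Suc m))) then H1 else H2))"
    using assms m by (intro forces_signal) (auto simp: circuit_def elim: inj_on_subset)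
  then show ?thesis
  proof (rule forces_mono)
    fix C assume "signal (b (C (c 0))) (C (c 1)) (C (c m)) (if b (C (c (Suc m))) then H1 else H2)"
    moreover have "c (Suc m) = c 0" using assms(1) m by (simp add: circuit_def)
    ultimately show "(C (c 1) = H0 \<or> C (c 1) = H2 \<and> C (c (n - 1)) = H2) = b (C (c 0))"
      unfolding m_def[symmetric]
      by (cases "C (c 1)"; cases "C (c m)") (auto simp: signal_def split: if_splits)
  qed (use m in auto)
qed

section \<open>Figure eights and dumbbells\<close>

text \<open>The circuits tell their common vertex whether its hat is \<open>H0\<close> and whether
  it is \<open>H1\<close>.\<close>

lemma forces_figure_eight:
  assumes c: "circuit N c n" and c': "circuit N c' n'" and eq: "c' 0 = c 0"
    and disj: "c ` {1..<n} \<inter> c' ` {1..<n'} = {}"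
  shows "forces N (c ` {0..<n} \<union> c' ` {0..<n'}) (\<lambda>_. False)"
\<comment> \<open>A circuit of length 3 wins alone; a longer one has the three inner sages that a
  signal requires.\<close>
proof (cases "n = 3 \<or> n' = 3")
  case True
  then show ?thesis
  proof
    assume "n = 3"
    then show ?thesis using c by (intro forces_mono[OF forces_circuit_3]) auto
  next
    assume "n' = 3"
    then show ?thesis using c' by (intro forces_mono[OF forces_circuit_3]) auto
  qed
next
  case False
  then have n: "4 \<le> n" "4 \<le> n'" using c c' by (auto simp: circuit_def)
  define K where "K p q \<longleftrightarrow> p = H0 \<or> p = H2 \<and> q = H2" for p q
  define g where "g C = (if K (C (c 1)) (C (c (n - 1))) then H0
    else if K (C (c' 1)) (C (c' (n' - 1))) then H1 else H2)" for C
  have nb: "c 1 \<in> N (c 0)" "c (n - 1) \<in> N (c 0)" "c' 1 \<in> N (c 0)" "c' (n' - 1) \<in> N (c 0)"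
    using walkD[of N c n 0] walkD[of N c n "n - 1"] walkD[of N c' n' 0] walkD[of N c' n' "n' - 1"]
      c c' n eq by (auto simp: circuit_def)
  have u: "forces N {c 0} (\<lambda>C. g C \<noteq> C (c 0))"
    by (rule forces_vertex) (simp add: nb[simplified] g_def)
  have "c 0 \<notin> c ` {1..<n}" "c' 0 \<notin> c' ` {1..<n'}"
    using c c' by (auto simp: circuit_def dest: inj_onD)
  then have "(c ` {1..<n} \<union> c' ` {1..<n'}) \<inter> {c 0} = {}" using eq by auto
  from forces_Un[OF forces_Un[OF forces_circuit_bit[OF c n(1), of "\<lambda>x. x = H0", folded K_def]
    forces_circuit_bit[OF c' n(2), of "\<lambda>x. x = H1", folded K_def] disj] u this]
  show ?thesis
  proof (rule forces_mono)
    show "c ` {1..<n} \<union> c' ` {1..<n'} \<union> {c 0} \<subseteq> c ` {0..<n} \<union> c' ` {0..<n'}"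
      using n by auto
  next
    fix C assume *: "(K (C (c 1)) (C (c (n - 1))) = (C (c 0) = H0) \<and>
      K (C (c' 1)) (C (c' (n' - 1))) = (C (c' 0) = H1)) \<and> g C \<noteq> C (c 0)"
    then show False unfolding eq g_def by (cases "C (c 0)") (auto split: if_splits)
  qed
qed

text \<open>\<open>c 0\<close> learns whether his hat is \<open>H0\<close>, and \<open>c' 0\<close>
  whether his is \<open>H1\<close>. The remaining doubt of \<open>c 0\<close> is passed along the
  path by relays, until it tells \<open>c' 0\<close> whether his hat is \<open>H0\<close>.\<close>

lemma forces_dumbbell:
  assumes c: "circuit N c n" and c': "circuit N c' n'"
    and s: "walk N s k" "inj_on s {0..k}" "s 0 = c 0" "s k = c' 0" and k: "1 \<le> k"
    and disj: "c ` {0..<n} \<inter> c' ` {0..<n'} = {}"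
      "s ` {1..<k} \<inter> (c ` {0..<n} \<union> c' ` {0..<n'}) = {}"
  shows "forces N (c ` {0..<n} \<union> c' ` {0..<n'} \<union> s ` {1..<k}) (\<lambda>_. False)"
proof (cases "n = 3 \<or> n' = 3")
  case True
  then show ?thesis
  proof
    assume "n = 3"
    then show ?thesis using c by (intro forces_mono[OF forces_circuit_3]) auto
  next
    assume "n' = 3"
    then show ?thesis using c' by (intro forces_mono[OF forces_circuit_3]) auto
  qed
next
  case False
  then have n: "4 \<le> n" "4 \<le> n'" using c c' by (auto simp: circuit_def)
  define K where "K p q \<longleftrightarrow> p = H0 \<or> p = H2 \<and> q = H2" for p q
  define gu where "gu C = (if K (C (c 1)) (C (c (n - 1))) then H0
    else if C (s 1) = H0 then H2 else H1)" for C
  define gw where "gw C = (if C (s (k - 1)) = H1 then H0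
    else if K (C (c' 1)) (C (c' (n' - 1))) then H1 else H2)" for C
  have nb: "c 1 \<in> N (c 0)" "c (n - 1) \<in> N (c 0)" "c' 1 \<in> N (c' 0)" "c' (n' - 1) \<in> N (c' 0)"
      "s 1 \<in> N (c 0)" "s (k - 1) \<in> N (c' 0)"
    using walkD[of N c n 0] walkD[of N c n "n - 1"] walkD[of N c' n' 0] walkD[of N c' n' "n' - 1"]
      walkD[of N s k 0] walkD[of N s k "k - 1"] c c' n s k by (auto simp: circuit_def)
  have u: "forces N {c 0} (\<lambda>C. gu C \<noteq> C (c 0))"
    by (rule forces_vertex) (simp add: nb[simplified] gu_def)
  have w: "forces N {c' 0} (\<lambda>C. gw C \<noteq> C (c' 0))"
    by (rule forces_vertex) (simp add: nb[simplified] gw_def)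
  have eq: "{1..<k} = {1..k - 1}" using k by auto
  have "walk N s (Suc (k - 1))" "inj_on s {1..k - 1}"
    using s(1) k by (simp, intro inj_on_subset[OF s(2)]) auto
  then have p: "forces N (s ` {1..<k}) (\<lambda>C. \<forall>i\<in>{1..k - 1}. relay (C (s (i - 1))) (C (s (Suc i))) \<noteq> C (s i))"
    unfolding eq by (rule forces_walk)
  have sets: "c 0 \<notin> c ` {1..<n}" "c' 0 \<notin> c' ` {1..<n'}"
    using c c' by (auto simp: circuit_def dest: inj_onD)
  have c0: "c 0 \<in> c ` {0..<n}" "c' 0 \<in> c' ` {0..<n'}" using n by auto
  have sub: "c ` {1..<n} \<union> {c 0} \<subseteq> c ` {0..<n}" "c' ` {1..<n'} \<union> {c' 0} \<subseteq> c' ` {0..<n'}"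
    using c0 by auto
  have d: "c ` {1..<n} \<inter> {c 0} = {}" "c' ` {1..<n'} \<inter> {c' 0} = {}"
    using sets by simp_all
  have mono: "X \<inter> Z = {}" if "X \<subseteq> Y" "Z \<subseteq> W" "Y \<inter> W = {}" for X Y Z W :: "'a set"
    using that by blast
  have d': "((c ` {1..<n} \<union> {c 0}) \<union> (c' ` {1..<n'} \<union> {c' 0})) \<inter> s ` {1..<k} = {}"
    using disj(2) by (intro mono[OF Un_mono[OF sub] subset_refl]) (simp add: Int_commute)
  from forces_Un[OF forces_Un[OF
      forces_Un[OF forces_circuit_bit[OF c n(1), of "\<lambda>x. x = H0", folded K_def] u d(1)]
      forces_Un[OF forces_circuit_bit[OF c' n(2), of "\<lambda>x. x = H1", folded K_def] w d(2)] mono[OF sub disj(1)]] p d']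
  show ?thesis
  proof (rule forces_mono)
    show "c ` {1..<n} \<union> {c 0} \<union> (c' ` {1..<n'} \<union> {c' 0}) \<union> s ` {1..<k}
      \<subseteq> c ` {0..<n} \<union> c' ` {0..<n'} \<union> s ` {1..<k}"
      by (intro Un_mono sub subset_refl)
  next
    fix C assume *: "((K (C (c 1)) (C (c (n - 1))) = (C (c 0) = H0) \<and> gu C \<noteq> C (c 0)) \<and>
      (K (C (c' 1)) (C (c' (n' - 1))) = (C (c' 0) = H1) \<and> gw C \<noteq> C (c' 0))) \<and>
      (\<forall>i\<in>{1..k - 1}. relay (C (s (i - 1))) (C (s (Suc i))) \<noteq> C (s i))"
    \<comment> \<open>Invariant along the path. An inner sage with \<open>H0\<close> would see
      \<open>H1\<close> before him and guess right, so his predecessor has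
      \<open>H2\<close>.\<close>
    have "C (s i) = (if C (s (Suc i)) = H0 then H1 else H2)" if "i < k" for i
      using that
    proof (induction i)
      case 0
      from * have "K (C (c 1)) (C (c (n - 1))) = (C (c 0) = H0)" "gu C \<noteq> C (c 0)" by auto
      then show ?case using s(3) by (cases "C (c 0)") (auto simp: gu_def split: if_splits)
    next
      case (Suc i)
      then have "relay (C (s i)) (C (s (Suc (Suc i)))) \<noteq> C (s (Suc i))"
        using * by (auto dest!: bspec[of _ _ "Suc i"])
      then show ?case using Suc by (cases "C (s (Suc i))") (auto simp: relay_def split: if_splits)
    qed
    from this[of "k - 1"] have "C (s (k - 1)) = (if C (c' 0) = H0 then H1 else H2)"
      using k s(4) by simp
    moreover from * have "K (C (c' 1)) (C (c' (n' - 1))) = (C (c' 0) = H1)" "gw C \<noteq> C (c' 0)"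
      by auto
    ultimately show False by (cases "C (c' 0)") (auto simp: gw_def split: if_splits)
  qed
qed

section \<open>Theta graphs\<close>

text \<open>\<open>k\<close> counts edges, so the inner vertices are the values of \<open>t\<close>
  on \<open>{1..<k}\<close>, and \<open>k = 1\<close> is a single edge.\<close>

definition link :: "('a \<Rightarrow> 'a set) \<Rightarrow> (nat \<Rightarrow> 'a) \<Rightarrow> nat \<Rightarrow> 'a \<Rightarrow> 'a \<Rightarrow> bool" where
  "link N t k u w \<longleftrightarrow> 1 \<le> k \<and> walk N t k \<and> inj_on t {0..k} \<and> t 0 = u \<and> t k = w"

lemma link_rev:
  assumes "link N t k u w"
  shows "link N (\<lambda>i. t (k - i)) k w u"
proof -
  have "walk N (\<lambda>i. t (k - i)) k"
    unfolding walk_def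
  proof (intro allI impI)
    fix i assume "i < k"
    then have "Suc (k - Suc i) = k - i" "k - Suc i < k" by auto
    then show "t (k - Suc i) \<in> N (t (k - i)) \<and> t (k - i) \<in> N (t (k - Suc i))"
      using walkD[of N t k "k - Suc i"] assms by (auto simp: link_def)
  qed
  moreover have "inj_on (\<lambda>i. t (k - i)) {0..k}"
  proof (rule inj_onI)
    fix i j assume ij: "i \<in> {0..k}" "j \<in> {0..k}" "t (k - i) = t (k - j)"
    moreover have "inj_on t {0..k}" using assms by (simp add: link_def)
    ultimately have "k - i = k - j" by (elim inj_onD) auto
    then show "i = j" using ij by auto
  qed
  ultimately show ?thesis using assms by (simp add: link_def)
qed

lemma link_rev_image: "(\<lambda>i. t (k - i)) ` {1..<k} = t ` {1..<(k::nat)}"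
proof -
  have "(\<lambda>i. k - i) ` {1..<k} = {1..<k}"
  proof
    show "{1..<k} \<subseteq> (\<lambda>i. k - i) ` {1..<k}"
    proof
      fix j assume "j \<in> {1..<k}"
      then show "j \<in> (\<lambda>i. k - i) ` {1..<k}" by (intro image_eqI[of _ _ "k - j"]) auto
    qed
  qed auto
  moreover have "(\<lambda>i. t (k - i)) ` {1..<k} = t ` (\<lambda>i. k - i) ` {1..<k}"
    by (simp add: image_image)
  ultimately show ?thesis by simp
qed

lemma link_ends:
  assumes "link N t k u w"
  shows "t 1 \<in> N u" "t (k - 1) \<in> N w" "u \<notin> t ` {1..<k}" "w \<notin> t ` {1..<k}" "u \<noteq> w"
proof -
  have k: "1 \<le> k" and wk: "walk N t k" and inj: "inj_on t {0..k}" and uw: "t 0 = u" "t k = w"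
    using assms by (auto simp: link_def)
  show "t 1 \<in> N u" "t (k - 1) \<in> N w"
    using walkD[OF wk, of 0] walkD[OF wk, of "k - 1"] k uw by auto
  have "t 0 \<noteq> t i" "t k \<noteq> t i" if "i \<in> {1..<k}" for i
    using inj_onD[OF inj, of 0 i] inj_onD[OF inj, of k i] that by auto
  then show "u \<notin> t ` {1..<k}" "w \<notin> t ` {1..<k}"
    using uw by blast+
  show "u \<noteq> w"
    using inj_onD[OF inj, of 0 k] k uw by auto
qed

lemma forces_link:
  assumes "link N t k u w"
  shows "forces N (t ` {1..<k}) (\<lambda>C. \<forall>i\<in>{1..<k}. g i (C (t (i - 1))) (C (t (Suc i))) \<noteq> C (t i))"
proof -
  have eq: "{1..<k} = {1..k - 1}" using assms by (auto simp: link_def)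
  have "inj_on t {0..k}" using assms by (simp add: link_def)
  then have "inj_on t {1..k - 1}" by (rule inj_on_subset) auto
  then show ?thesis unfolding eq using assms by (intro forces_walk) (auto simp: link_def)
qed

lemma forces_link_signal:
  assumes "link N t k u w" "4 \<le> k" "\<And>y. v y \<noteq> H0"
  shows "forces N (t ` {1..<k}) (\<lambda>C. signal (b (C u)) (C (t 1)) (C (t (k - 1))) (v (C w)))"
proof -
  have eq: "{1..<k} = {1..k - 1}" using assms by auto
  have "inj_on t {0..k}" using assms by (simp add: link_def)
  then have "inj_on t {1..k - 1}" by (rule inj_on_subset) auto
  moreover have "Suc (k - 1) = k" using assms(2) by simp
  ultimately have "forces N (t ` {1..k - 1})
      (\<lambda>C. signal (b (C (t 0))) (C (t 1)) (C (t (k - 1))) (v (C (t (Suc (k - 1))))))"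
    using assms by (intro forces_signal) (auto simp: link_def)
  then show ?thesis
    unfolding eq using \<open>Suc (k - 1) = k\<close> assms(1) by (simp add: link_def)
qed

text \<open>The circuit runs out along \<open>s\<close> and back along \<open>t\<close>; the length
  bound excludes two copies of one edge.\<close>

lemma circuit_links:
  assumes "link N s j u w" "link N t k u w" "s ` {1..<j} \<inter> t ` {1..<k} = {}" "3 \<le> j + k"
  obtains c where "circuit N c (j + k)" "c ` {0..<j + k} \<subseteq> s ` {0..j} \<union> t ` {0..k}"
proof
  define c where "c i = (if i \<le> j then s i else t (j + k - i))" for i
  have j: "1 \<le> j" "walk N s j" "inj_on s {0..j}" "s 0 = u" "s j = w"
    and k: "1 \<le> k" "walk N t k" "inj_on t {0..k}" "t 0 = u" "t k = w"
    using assms by (auto simp: link_def)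
  have "walk N c (j + k)"
    unfolding walk_def
  proof (intro allI impI)
    fix i assume i: "i < j + k"
    show "c (Suc i) \<in> N (c i) \<and> c i \<in> N (c (Suc i))"
    proof (cases "i < j")
      case True
      then show ?thesis using walkD[OF j(2)] by (auto simp: c_def)
    next
      case False
      then have ci: "c i = t (j + k - i)" using j k by (auto simp: c_def)
      have *: "Suc (j + k - Suc i) = j + k - i" "j + k - Suc i < k" using False i by auto
      have "c (Suc i) = t (j + k - Suc i)" using False by (auto simp: c_def)
      then show ?thesis using walkD[OF k(2) *(2)] ci *(1) by simp
    qed
  qed
  moreover have "inj_on c {0..<j + k}"
  proof (rule inj_onI)
    have st: "s a \<noteq> t b" if ab: "a \<le> j" "1 \<le> b" "b < k" for a b
    proof -
      consider "a = 0" | "a = j" | "1 \<le> a \<and> a < j" using ab by linarith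
      then show ?thesis
      proof cases
        case 1
        then show ?thesis using j(4) k(1,4) ab inj_onD[OF k(3), of 0 b] by auto
      next
        case 2
        then show ?thesis using j(5) k(1,5) ab inj_onD[OF k(3), of k b] by auto
      next
        case 3
        then have "s a \<in> s ` {1..<j}" "t b \<in> t ` {1..<k}" using ab by auto
        then show ?thesis using assms(3) by (metis disjoint_iff)
      qed
    qed
    fix x y assume xy: "x \<in> {0..<j + k}" "y \<in> {0..<j + k}" "c x = c y"
    consider "x \<le> j" "y \<le> j" | "x \<le> j" "j < y" | "j < x" "y \<le> j" | "j < x" "j < y" by linarith
    then show "x = y"
    proof cases
      case 1
      then show ?thesis using xy j(3) by (auto simp: c_def dest: inj_onD)
    next
      case 2
      then show ?thesis using xy st[of x "j + k - y"] by (auto simp: c_def)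
    next
      case 3
      have "1 \<le> j + k - x" "j + k - x < k" using 3 xy by auto
      then show ?thesis using 3 xy st[OF 3(2), of "j + k - x"] by (auto simp: c_def)
    next
      case 4
      then have "j + k - x = j + k - y"
        using xy by (intro inj_onD[OF k(3)]) (auto simp: c_def)
      then show ?thesis using xy by auto
    qed
  qed
  moreover have "c (j + k) = c 0" using j k by (auto simp: c_def)
  ultimately show "circuit N c (j + k)" using assms(4) by (simp add: circuit_def)
  show "c ` {0..<j + k} \<subseteq> s ` {0..j} \<union> t ` {0..k}"
    by (auto simp: c_def)
qed

text \<open>Reduces a theta graph to a check on finitely many hats, \<open>contra\<close>. The
  branch vertices guess by \<open>U\<close> and \<open>W\<close> from their three neighbours on the
  paths.\<close>

lemma forces_theta:
  assumes L: "link N t0 k0 u w" "link N t1 k1 u w" "link N t2 k2 u w"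
    and D: "t0 ` {1..<k0} \<inter> t1 ` {1..<k1} = {}" "t0 ` {1..<k0} \<inter> t2 ` {1..<k2} = {}"
      "t1 ` {1..<k1} \<inter> t2 ` {1..<k2} = {}"
    and P: "forces N (t0 ` {1..<k0}) P0" "forces N (t1 ` {1..<k1}) P1" "forces N (t2 ` {1..<k2}) P2"
    and contra: "\<And>C. P0 C \<Longrightarrow> P1 C \<Longrightarrow> P2 C \<Longrightarrow> U (C (t0 1)) (C (t1 1)) (C (t2 1)) \<noteq> C u \<Longrightarrow>
      W (C (t0 (k0 - 1))) (C (t1 (k1 - 1))) (C (t2 (k2 - 1))) \<noteq> C w \<Longrightarrow> False"
  shows "forces N (t0 ` {0..k0} \<union> t1 ` {0..k1} \<union> t2 ` {0..k2}) (\<lambda>_. False)"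
proof -
  note E = link_ends[OF L(1)] link_ends[OF L(2)] link_ends[OF L(3)]
  have u: "forces N {u} (\<lambda>C. U (C (t0 1)) (C (t1 1)) (C (t2 1)) \<noteq> C u)"
    by (rule forces_vertex) (simp add: E[simplified])
  have w: "forces N {w} (\<lambda>C. W (C (t0 (k0 - 1))) (C (t1 (k1 - 1))) (C (t2 (k2 - 1))) \<noteq> C w)"
    by (rule forces_vertex) (simp add: E[simplified])
  have D': "(t0 ` {1..<k0} \<union> t1 ` {1..<k1}) \<inter> t2 ` {1..<k2} = {}" "{u} \<inter> {w} = {}"
      "(t0 ` {1..<k0} \<union> t1 ` {1..<k1} \<union> t2 ` {1..<k2}) \<inter> ({u} \<union> {w}) = {}"
    using D E by (simp_all add: Int_Un_distrib Int_Un_distrib2)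
  have uw: "u \<in> t0 ` {0..k0}" "w \<in> t0 ` {0..k0}"
    using L(1) by (auto simp: link_def)
  have sub: "t ` {1..<k} \<subseteq> t ` {0..k}" for t :: "nat \<Rightarrow> 'a" and k by auto
  show ?thesis
  proof (rule forces_mono[OF forces_Un[OF forces_Un[OF forces_Un[OF P(1,2) D(1)] P(3) D'(1)]
          forces_Un[OF u w D'(2)] D'(3)]])
    show "t0 ` {1..<k0} \<union> t1 ` {1..<k1} \<union> t2 ` {1..<k2} \<union> ({u} \<union> {w})
      \<subseteq> t0 ` {0..k0} \<union> t1 ` {0..k1} \<union> t2 ` {0..k2}"
      using sub[of t0 k0] sub[of t1 k1] sub[of t2 k2] uw by (simp add: le_supI1 le_supI2)
  qed (elim conjE, rule contra)
qed

text \<open>\<open>far0\<close> and \<open>far1\<close> encode the bits \<open>y = H2\<close> and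
  \<open>y = H1\<close> of the far branch vertex: an end hat that is neither \<open>H0\<close> nor
  the code is \<open>H1\<close> if the bit holds and \<open>H2\<close> if not.\<close>

definition far0 :: "hat \<Rightarrow> hat" where
  "far0 y = (if y = H2 then H2 else H1)"

definition far1 :: "hat \<Rightarrow> hat" where
  "far1 y = (if y = H1 then H2 else H1)"

lemmas theta_defs = signal_def far0_def far1_def

lemma far_neq [simp]: "far0 y \<noteq> H0" "far1 y \<noteq> H0"
  by (auto simp: far0_def far1_def)

text \<open>\<open>c0 = H0\<close> is read as \<open>x = H2\<close>, and \<open>c1 = H0\<close> as
  \<open>x \<noteq> H0\<close>. The flags \<open>p\<close> and \<open>q\<close>, set from the third
  path, switch to the hat that a misread \<open>c0\<close> or \<open>c1\<close> would
  conceal.\<close>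

definition near_guess :: "bool \<Rightarrow> bool \<Rightarrow> hat \<Rightarrow> hat \<Rightarrow> hat" where
  "near_guess p q c0 c1 = (if c0 = H0 then H2 else if c1 = H0 then (if p then H2 else H1)
     else if q then H1 else H0)"

text \<open>For adjacent branch vertices, which see each other's hats \<open>x\<close> and
  \<open>y\<close>; the two other paths are long.\<close>

lemma direct_guess:
  assumes "signal (x = H2) c0 e0 (far0 y)" "signal (x \<noteq> H0) c1 e1 (far1 y)"
    and "near_guess (y = H1) (y = H0) c0 c1 \<noteq> x"
    and "(if e0 \<noteq> H0 \<and> e1 \<noteq> H0 then if e0 = H1 then H2 else if e1 = H1 then H1 else H0
      else if x = H0 then H0 else if x = H1 then if e1 = H2 then H2 else H1
      else if e0 = H1 then H2 else H0) \<noteq> y"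
  shows False
  using assms[unfolded theta_defs near_guess_def]
  by (cases x; cases y; simp?; cases c0; simp?; cases c1; simp?; cases e0; simp?; cases e1; simp?)

text \<open>\<open>s\<close> is the hat of the only inner sage of a path with two edges; the two
  other paths are long.\<close>

lemma single_guess:
  assumes "signal (x = H2) c0 e0 (far0 y)" "signal (x \<noteq> H0) c1 e1 (far1 y)"
    and "(if x = H0 \<or> x = H2 \<and> y = H0 then H2 else if x = H1 \<and> y \<noteq> H0 then H1 else H0) \<noteq> s"
    and "near_guess (s = H1) (s = H2) c0 c1 \<noteq> x"
    and "(if e0 = H1 then H2 else if e1 = H1 then H1 else if e0 \<noteq> H0 \<and> e1 \<noteq> H0 then H0
      else if e1 = H2 then if s = H0 then H2 else H0 else if s = H2 then H1 else H0) \<noteq> y"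
  shows False
  using assms[unfolded theta_defs near_guess_def]
  by (cases x; cases y; simp?; cases s; simp?; cases c0; simp?; cases c1; simp?; cases e0; simp?; cases e1; simp?)

text \<open>\<open>s\<close> and \<open>t\<close> are the inner hats of a path with three edges; the
  two other paths are long.\<close>

lemma double_guess:
  assumes "signal (x = H2) c0 e0 (far0 y)" "signal (x \<noteq> H0) c1 e1 (far1 y)"
    and "(if x = H0 \<or> x = H2 \<and> t = H2 then H0 else if x = H1 \<and> t \<noteq> H1 then H1 else H2) \<noteq> s"
    and "(if s = H2 then if y = H0 then H0 else H2
      else if y = H0 \<or> s = H1 \<and> y = H2 then H1 else H0) \<noteq> t"
    and "near_guess (s = H1) (s = H0) c0 c1 \<noteq> x"
    and "(if e0 = H1 then H2 else if e1 = H1 then H1 else if e0 \<noteq> H0 \<and> e1 \<noteq> H0 then H0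
      else if e1 = H2 then if t = H0 then H2 else H0 else if t = H1 then H1 else H0) \<noteq> y"
  shows False
  using assms[unfolded theta_defs near_guess_def]
  by (cases x; cases y; simp?; cases s; simp?; cases t; simp?; cases c0; simp?; cases c1; simp?; cases e0; simp?; cases e1; simp?)

text \<open>For three long paths. The third signal runs in the opposite direction, so its freely
  readable bit is that of \<open>w\<close>.\<close>

lemma triple_guess:
  assumes "signal (x = H1) c0 e0 (far0 y)" "signal (x \<noteq> H0) c1 e1 (far1 y)"
    and "signal (y \<noteq> H0) e2 c2 (far0 x)"
    and "(if c0 = H0 then H1 else if c2 = H1 then H2 else if c2 = H2 then if c1 = H0 then H1 else H0
      else if c1 = H0 then H2 else H0) \<noteq> x"
    and "(if e0 = H1 then H2 else if e1 = H1 then H1 else if e0 \<noteq> H0 \<and> e1 \<noteq> H0 then H0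
      else if e2 \<noteq> H0 then H0 else if e0 \<noteq> H0 then H1 else H2) \<noteq> y"
  shows False
  using assms[unfolded theta_defs]
  by (cases x; cases y; simp?; cases c0; simp?; cases c1; simp?; cases c2; simp?; cases e0; simp?; cases e1; simp?; cases e2; simp?)

text \<open>
  Paths with two and three edges form a cycle of length 5, on which \<open>u\<close> or \<open>w\<close> knows one bit of his own
  hat through the third path, and \<open>w\<close> knows which case holds.
\<close>

lemma short_guess:
  assumes "signal (x = H2) c e (far0 y)"
    and "(case x of H0 \<Rightarrow> if y = H1 then H2 else H1 | H1 \<Rightarrow> if y = H0 then H2 else H0
      | H2 \<Rightarrow> if y = H0 then H1 else H0) \<noteq> s"
    and "(case x of H0 \<Rightarrow> if r = H0 then H0 else H2 | H1 \<Rightarrow> if r = H2 then H1 else H0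
      | H2 \<Rightarrow> (case r of H0 \<Rightarrow> H0 | H1 \<Rightarrow> H2 | H2 \<Rightarrow> H1)) \<noteq> t"
    and "(case t of H0 \<Rightarrow> if y = H0 then H1 else H2 | H1 \<Rightarrow> if y = H1 then H1 else H0
      | H2 \<Rightarrow> if y = H1 then H2 else H0) \<noteq> r"
    and "(if c = H0 then H2 else if s = H2 then rot (rot t) else s) \<noteq> x"
    and "(if e = H1 then H2 else if s = H1 \<or> r = H0 then H1
      else if e = H0 \<and> s = H2 \<and> r = H1 then H2 else H0) \<noteq> y"
  shows False
  using assms[unfolded theta_defs]
  by (cases x; cases y; simp?; cases s; simp?; cases t; simp?; cases r; simp?; cases c; simp?; cases e; simp?)

text \<open>If two links form a winning circuit, it suffices. Otherwise only those length patterns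
  remain for which explicit guesses are given above.\<close>

lemma forces_theta_sorted:
  assumes L: "link N t0 k0 u w" "link N t1 k1 u w" "link N t2 k2 u w"
    and D: "t0 ` {1..<k0} \<inter> t1 ` {1..<k1} = {}" "t0 ` {1..<k0} \<inter> t2 ` {1..<k2} = {}"
      "t1 ` {1..<k1} \<inter> t2 ` {1..<k2} = {}"
    and le: "k0 \<le> k1" "k1 \<le> k2" "1 < k1"
  shows "forces N (t0 ` {0..k0} \<union> t1 ` {0..k1} \<union> t2 ` {0..k2}) (\<lambda>_. False)"
proof (cases "winning_length (k0 + k1) \<or> winning_length (k0 + k2) \<or> winning_length (k1 + k2)")
  case True
  have k: "1 \<le> k0" using L by (auto simp: link_def)
  have *: ?thesis if asm: "link N s j u w" "link N t k u w" "s ` {1..<j} \<inter> t ` {1..<k} = {}" "3 \<le> j + k"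
      "winning_length (j + k)"
      "s ` {0..j} \<union> t ` {0..k} \<subseteq> t0 ` {0..k0} \<union> t1 ` {0..k1} \<union> t2 ` {0..k2}" for s t j k
  proof -
    obtain c where c: "circuit N c (j + k)" "c ` {0..<j + k} \<subseteq> s ` {0..j} \<union> t ` {0..k}"
      using circuit_links[OF asm(1-4)] .
    show ?thesis
      by (rule forces_mono[OF forces_circuit[OF c(1) asm(5)] subset_trans[OF c(2) asm(6)]])
  qed
  from True show ?thesis
  proof (elim disjE)
    assume "winning_length (k0 + k1)"
    then show ?thesis using k le by (intro *[OF L(1,2) D(1)]) (simp_all add: le_supI1 le_supI2)
  next
    assume "winning_length (k0 + k2)"
    then show ?thesis using k le by (intro *[OF L(1,3) D(2)]) (simp_all add: le_supI1 le_supI2)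
  next
    assume "winning_length (k1 + k2)"
    then show ?thesis using k le by (intro *[OF L(2,3) D(3)]) (simp_all add: le_supI1 le_supI2)
  qed
next
  case False
  have k: "1 \<le> k0" using L by (auto simp: link_def)
  have nw: "\<not> 3 dvd k0 + k1" "k0 + k1 \<noteq> 4" "\<not> 3 dvd k0 + k2" "\<not> 3 dvd k1 + k2"
    using False by (auto simp: winning_length_def)
  \<comment> \<open>\<open>k0 = 1\<close> rules out \<open>k1 = 2\<close> and \<open>k1 = 3\<close>
    (circuits of length 3 and 4), \<open>k0 = 2\<close> rules out \<open>k1 = 2\<close>, and two
    links of length 3 would form a circuit of length 6.\<close>
  have k_cases: "k0 = 1 \<and> 4 \<le> k1 \<or> k0 = 2 \<and> k1 = 3 \<and> 4 \<le> k2 \<or> k0 = 2 \<and> 4 \<le> k1 \<or> k0 = 3 \<and> 4 \<le> k1 \<or> 4 \<le> k0"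
    using nw le k by presburger
  have arith: "Suc 1 = 2" "Suc 2 = 3" "1 - 1 = (0::nat)" "2 - 1 = (1::nat)" "(2::nat) = 1 \<longleftrightarrow> False"
    by auto
  consider "k0 = 1" "4 \<le> k1" | "k0 = 2" "k1 = 3" "4 \<le> k2" | "k0 = 2" "4 \<le> k1"
    | "k0 = 3" "4 \<le> k1" | "4 \<le> k0"
    using k_cases by blast
  then show ?thesis
  proof cases
    case 1
    then have k2: "4 \<le> k2" using le by simp
    \<comment> \<open>On a link with one edge the branch vertices are each other's neighbours, so
      \<open>U\<close> receives the hat of \<open>w\<close> and \<open>W\<close> that of
      \<open>u\<close>.\<close>
    have eq: "t0 1 = w" "t0 (k0 - 1) = u" using L(1) 1 by (auto simp: link_def)
    note S = forces_link_signal[OF L(2) 1(2), of far0 "\<lambda>x. x = H2"]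
      forces_link_signal[OF L(3) k2, of far1 "\<lambda>x. x \<noteq> H0"]
    show ?thesis
    proof (rule forces_theta[OF L D forces_link[OF L(1), of "\<lambda>_ _ _. H0"]
              S(1)[OF far_neq(1)] S(2)[OF far_neq(2)],
          where U = "\<lambda>y c0 c1. near_guess (y = H1) (y = H0) c0 c1" and
            W = "\<lambda>x e0 e1. if e0 \<noteq> H0 \<and> e1 \<noteq> H0 then if e0 = H1 then H2
              else if e1 = H1 then H1 else H0
              else if x = H0 then H0 else if x = H1 then if e1 = H2 then H2 else H1
              else if e0 = H1 then H2 else H0"])
    qed (unfold eq, erule (3) direct_guess)
  next
    case 2
    have eq: "t0 (k0 - 1) = t0 1" "t0 2 = w" "t0 0 = u" "t1 0 = u" "t1 (k1 - 1) = t1 2" "t1 3 = w"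
      using L(1,2) 2 by (auto simp: link_def)
    have mem: "1 \<in> {1..<k0}" "1 \<in> {1..<k1}" "2 \<in> {1..<k1}" using 2 by auto
    note S = forces_link_signal[OF L(3) 2(3), of far0 "\<lambda>x. x = H2"]
    show ?thesis
    proof (rule forces_theta[OF L D forces_link[OF L(1),
            of "\<lambda>i x y. case x of H0 \<Rightarrow> if y = H1 then H2 else H1
              | H1 \<Rightarrow> if y = H0 then H2 else H0 | H2 \<Rightarrow> if y = H0 then H1
              else H0"] forces_link[OF L(2),
            of "\<lambda>i a c. if i = 1 then (case a of H0 \<Rightarrow> if c = H0 then H0 else H2
              | H1 \<Rightarrow> if c = H2 then H1 else H0
              | H2 \<Rightarrow> (case c of H0 \<Rightarrow> H0 | H1 \<Rightarrow> H2
              | H2 \<Rightarrow> H1)) else (case a of H0 \<Rightarrow> if c = H0 then H1 else H2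
              | H1 \<Rightarrow> if c = H1 then H1 else H0 | H2 \<Rightarrow> if c = H1 then H2
              else H0)"] S[OF far_neq(1)],
          where U = "\<lambda>s t c. if c = H0 then H2 else if s = H2 then rot (rot t) else s" and
            W = "\<lambda>s r e. if e = H1 then H2 else if s = H1 \<or> r = H0 then H1
              else if e = H0 \<and> s = H2 \<and> r = H1 then H2 else H0"])
      fix C
      assume p0: "\<forall>i\<in>{1..<k0}. (\<lambda>i x y. case x of H0 \<Rightarrow> if y = H1 then H2 else H1
          | H1 \<Rightarrow> if y = H0 then H2 else H0 | H2 \<Rightarrow> if y = H0 then H1 else H0) i
          (C (t0 (i - 1))) (C (t0 (Suc i))) \<noteq> C (t0 i)"
        and p1: "\<forall>i\<in>{1..<k1}. (\<lambda>i a c. if i = 1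
              then (case a of H0 \<Rightarrow> if c = H0 then H0 else H2
            | H1 \<Rightarrow> if c = H2 then H1 else H0
              | H2 \<Rightarrow> (case c of H0 \<Rightarrow> H0 | H1 \<Rightarrow> H2 | H2 \<Rightarrow> H1))
          else (case a of H0 \<Rightarrow> if c = H0 then H1 else H2 | H1 \<Rightarrow> if c = H1
              then H1 else H0
            | H2 \<Rightarrow> if c = H1 then H2
              else H0)) i (C (t1 (i - 1))) (C (t1 (Suc i))) \<noteq> C (t1 i)"
        and rest: "signal (C u = H2) (C (t2 1)) (C (t2 (k2 - 1))) (far0 (C w))"
          "(if C (t2 1) = H0 then H2 else if C (t0 1) = H2 then rot (rot (C (t1 1)))
              else C (t0 1)) \<noteq> C u"
          "(if C (t2 (k2 - 1)) = H1 then H2 else if C (t0 (k0 - 1)) = H1 \<or> C (t1 (k1 - 1)) = H0 then H1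
            else if C (t2 (k2 - 1)) = H0 \<and> C (t0 (k0 - 1)) = H2 \<and> C (t1 (k1 - 1)) = H1
              then H2 else H0) \<noteq> C w"
      show False
        using short_guess[OF rest(1) bspec[OF p0 mem(1), unfolded arith eq]
            bspec[OF p1 mem(2), unfolded arith eq simp_thms if_True if_False]
            bspec[OF p1 mem(3), unfolded arith eq simp_thms if_True if_False] rest(2) rest(3)[unfolded eq]] .
    qed
  next
    case 3
    then have k2: "4 \<le> k2" using le by simp
    have eq: "t0 (k0 - 1) = t0 1" "t0 2 = w" "t0 0 = u" using L(1) 3 by (auto simp: link_def)
    have mem: "1 \<in> {1..<k0}" using 3 by auto
    note S = forces_link_signal[OF L(2) 3(2), of far0 "\<lambda>x. x = H2"]
      forces_link_signal[OF L(3) k2, of far1 "\<lambda>x. x \<noteq> H0"]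
    show ?thesis
    proof (rule forces_theta[OF L D forces_link[OF L(1),
            of "\<lambda>i x y. if x = H0 \<or> x = H2 \<and> y = H0 then H2
              else if x = H1 \<and> y \<noteq> H0 then H1 else H0"] S(1)[OF far_neq(1)] S(2)[OF far_neq(2)],
          where U = "\<lambda>s c0 c1. near_guess (s = H1) (s = H2) c0 c1" and
            W = "\<lambda>s e0 e1. if e0 = H1 then H2 else if e1 = H1 then H1
              else if e0 \<noteq> H0 \<and> e1 \<noteq> H0 then H0
              else if e1 = H2 then if s = H0 then H2 else H0 else if s = H2 then H1 else H0"])
      fix C
      assume p0: "\<forall>i\<in>{1..<k0}. (\<lambda>i x y. if x = H0 \<or> x = H2 \<and> y = H0 then H2
          else if x = H1 \<and> y \<noteq> H0 then H1
              else H0) i (C (t0 (i - 1))) (C (t0 (Suc i))) \<noteq> C (t0 i)"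
        and rest: "signal (C u = H2) (C (t1 1)) (C (t1 (k1 - 1))) (far0 (C w))"
          "signal (C u \<noteq> H0) (C (t2 1)) (C (t2 (k2 - 1))) (far1 (C w))"
          "near_guess (C (t0 1) = H1) (C (t0 1) = H2) (C (t1 1)) (C (t2 1)) \<noteq> C u"
          "(if C (t1 (k1 - 1)) = H1 then H2 else if C (t2 (k2 - 1)) = H1 then H1
            else if C (t1 (k1 - 1)) \<noteq> H0 \<and> C (t2 (k2 - 1)) \<noteq> H0 then H0
            else if C (t2 (k2 - 1)) = H2 then if C (t0 (k0 - 1)) = H0 then H2 else H0
            else if C (t0 (k0 - 1)) = H2 then H1 else H0) \<noteq> C w"
      show False
        using single_guess[OF rest(1,2) bspec[OF p0 mem, unfolded arith eq] rest(3) rest(4)[unfolded eq]] .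
    qed
  next
    case 4
    then have k2: "4 \<le> k2" using le by simp
    have eq: "t0 (k0 - 1) = t0 2" "t0 3 = w" "t0 0 = u" using L(1) 4 by (auto simp: link_def)
    have mem: "1 \<in> {1..<k0}" "2 \<in> {1..<k0}" using 4 by auto
    note S = forces_link_signal[OF L(2) 4(2), of far0 "\<lambda>x. x = H2"]
      forces_link_signal[OF L(3) k2, of far1 "\<lambda>x. x \<noteq> H0"]
    show ?thesis
    proof (rule forces_theta[OF L D forces_link[OF L(1),
            of "\<lambda>i a c. if i = 1 then if a = H0 \<or> a = H2 \<and> c = H2 then H0
              else if a = H1 \<and> c \<noteq> H1 then H1 else H2 else if a = H2 then if c = H0
              then H0 else H2 else if c = H0 \<or> a = H1 \<and> c = H2 then H1 else H0"]
              S(1)[OF far_neq(1)] S(2)[OF far_neq(2)],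
          where U = "\<lambda>s c0 c1. near_guess (s = H1) (s = H0) c0 c1" and
            W = "\<lambda>t e0 e1. if e0 = H1 then H2 else if e1 = H1 then H1
              else if e0 \<noteq> H0 \<and> e1 \<noteq> H0 then H0
              else if e1 = H2 then if t = H0 then H2 else H0 else if t = H1 then H1 else H0"])
      fix C
      assume p0: "\<forall>i\<in>{1..<k0}. (\<lambda>i a c. if i = 1
          then if a = H0 \<or> a = H2 \<and> c = H2 then H0 else if a = H1 \<and> c \<noteq> H1 then H1 else H2
          else if a = H2 then if c = H0 then H0 else H2 else if c = H0 \<or> a = H1 \<and> c = H2
              then H1 else H0)
          i (C (t0 (i - 1))) (C (t0 (Suc i))) \<noteq> C (t0 i)"
        and rest: "signal (C u = H2) (C (t1 1)) (C (t1 (k1 - 1))) (far0 (C w))"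
          "signal (C u \<noteq> H0) (C (t2 1)) (C (t2 (k2 - 1))) (far1 (C w))"
          "near_guess (C (t0 1) = H1) (C (t0 1) = H0) (C (t1 1)) (C (t2 1)) \<noteq> C u"
          "(if C (t1 (k1 - 1)) = H1 then H2 else if C (t2 (k2 - 1)) = H1 then H1
            else if C (t1 (k1 - 1)) \<noteq> H0 \<and> C (t2 (k2 - 1)) \<noteq> H0 then H0
            else if C (t2 (k2 - 1)) = H2 then if C (t0 (k0 - 1)) = H0 then H2 else H0
            else if C (t0 (k0 - 1)) = H1 then H1 else H0) \<noteq> C w"
      show False
        using double_guess[OF rest(1,2) bspec[OF p0 mem(1), unfolded arith eq simp_thms if_True if_False]
            bspec[OF p0 mem(2), unfolded arith eq simp_thms if_True if_False] rest(3) rest(4)[unfolded eq]] .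
    qed
  next
    case 5
    then have k12: "4 \<le> k1" "4 \<le> k2" using le by auto
    have S2: "forces N (t2 ` {1..<k2})
        (\<lambda>C. signal (C w \<noteq> H0) (C (t2 (k2 - 1))) (C (t2 1)) (far0 (C u)))"
      using forces_link_signal[OF link_rev[OF L(3)] k12(2), of far0 "\<lambda>x. x \<noteq> H0"] k12
      by (simp add: link_rev_image[simplified])
    note S = forces_link_signal[OF L(1) 5, of far0 "\<lambda>x. x = H1"]
      forces_link_signal[OF L(2) k12(1), of far1 "\<lambda>x. x \<noteq> H0"]
    show ?thesis
    proof (rule forces_theta[OF L D S(1)[OF far_neq(1)] S(2)[OF far_neq(2)] S2,
          where U = "\<lambda>c0 c1 c2. if c0 = H0 then H1 else if c2 = H1 then H2
              else if c2 = H2 then if c1 = H0 then H1 else H0 else if c1 = H0 then H2 else H0" and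
            W = "\<lambda>e0 e1 e2. if e0 = H1 then H2 else if e1 = H1 then H1
              else if e0 \<noteq> H0 \<and> e1 \<noteq> H0 then H0
              else if e2 \<noteq> H0 then H0 else if e0 \<noteq> H0 then H1 else H2"])
    qed (erule (4) triple_guess)
  qed
qed

section \<open>Losing cycles\<close>

definition cnt :: "(hat \<Rightarrow> bool) \<Rightarrow> nat" where
  "cnt P = of_bool (P H0) + of_bool (P H1) + of_bool (P H2)"

lemma cnt_0: "cnt P = 0 \<Longrightarrow> \<not> P x"
  by (cases x) (auto simp: cnt_def)

lemma cnt_pos: "P x \<Longrightarrow> 1 \<le> cnt P"
  by (cases x) (auto simp: cnt_def)

lemma cnt_ge_2: "P x \<Longrightarrow> P y \<Longrightarrow> x \<noteq> y \<Longrightarrow> 2 \<le> cnt P"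
  by (cases x; cases y) (auto simp: cnt_def)

lemma cnt_le_2_ex: "cnt P \<le> 2 \<Longrightarrow> \<exists>x. \<not> P x"
  by (rule ccontr) (simp add: cnt_def)

lemma cnt_le_1_ex:
  assumes "cnt P \<le> 1"
  obtains x y where "x \<noteq> y" "\<not> P x" "\<not> P y"
proof -
  have "\<exists>x y. x \<noteq> y \<and> \<not> P x \<and> \<not> P y"
    using assms by (cases "P H0"; cases "P H1"; cases "P H2") (auto simp: cnt_def)
  then show thesis using that by blast
qed

lemma cnt_ge_2_ex: "2 \<le> cnt P \<Longrightarrow> \<exists>x y. x \<noteq> y \<and> P x \<and> P y"
  by (cases "P H0"; cases "P H1"; cases "P H2") (auto simp: cnt_def)

lemma cnt_mono:
  assumes "\<And>x. P x \<Longrightarrow> Q x"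
  shows "cnt P \<le> cnt Q"
  using assms[of H0] assms[of H1] assms[of H2] by (auto simp: cnt_def of_bool_def)

lemma cnt_mono_eq:
  assumes "\<And>x. P x \<Longrightarrow> Q x" "cnt Q \<le> cnt P" "Q x"
  shows "P x"
  using assms(1)[of H0] assms(1)[of H1] assms(1)[of H2] assms(2,3)
  by (cases x) (auto simp: cnt_def of_bool_def split: if_splits)

lemma cnt_le_2I: "\<not> P x \<Longrightarrow> cnt P \<le> 2"
  by (cases x) (auto simp: cnt_def of_bool_def)

lemma cnt_pos_ex: "1 \<le> cnt P \<Longrightarrow> \<exists>x. P x"
  by (rule ccontr) (simp add: cnt_def)

lemma cnt_fibres: "cnt (\<lambda>b. h b = H0) + cnt (\<lambda>b. h b = H1) + cnt (\<lambda>b. h b = H2) = 3"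
  unfolding cnt_def by (cases "h H0"; cases "h H1"; cases "h H2") simp_all

lemma all_hat: "(\<forall>x. P x) \<longleftrightarrow> P H0 \<and> P H1 \<and> P H2"
  by (metis hat.exhaust)

lemma hat_pigeonhole:
  fixes A B :: "hat \<Rightarrow> bool"
  assumes "\<And>w. A w \<or> B w"
  shows "(\<exists>w w'. w \<noteq> w' \<and> A w \<and> A w') \<or> (\<exists>w w'. w \<noteq> w' \<and> B w \<and> B w')"
  using assms[of H0] assms[of H1] assms[of H2] by auto

lemma two_other_hats: "\<exists>z z'. z \<noteq> z' \<and> x \<noteq> z \<and> x \<noteq> (z' :: hat)"
  by (cases x) auto

text \<open>The sages of a cycle are numbered periodically by all naturals, and
  \<open>f i a b\<close> is the guess of sage \<open>i\<close> from the hats before and after him.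
  The offset \<open>s\<close> lets an argument start at any sage; positions \<open>n\<close> and
  \<open>Suc n\<close> repeat \<open>0\<close> and \<open>1\<close>.\<close>

locale winning_cycle =
  fixes f :: "nat \<Rightarrow> hat \<Rightarrow> hat \<Rightarrow> hat" and n :: nat
  assumes n: "5 \<le> n"
    and periodic: "f (i + n) = f i"
    and wins: "c n = c 0 \<Longrightarrow> c (Suc n) = c 1 \<Longrightarrow>
      \<exists>i\<in>{1..n}. f (s + i) (c (i - 1)) (c (Suc i)) = c i"
begin

text \<open>
  \<open>reach s p a i\<close> collects the possible hats of the sages \<open>s + i\<close> and \<open>s + i + 1\<close> when the sages \<open>s\<close> and \<open>s + 1\<close>
  have hats \<open>p\<close> and \<open>a\<close> and the sages \<open>s + 1, \<dots>, s + i\<close> are wrong.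
\<close>

primrec reach :: "nat \<Rightarrow> hat \<Rightarrow> hat \<Rightarrow> nat \<Rightarrow> (hat \<times> hat) set" where
  "reach s p a 0 = {(p, a)}"
| "reach s p a (Suc i) = {(z, w). \<exists>y. (y, z) \<in> reach s p a i \<and> f (s + Suc i) y w \<noteq> z}"

lemma reach_sequence:
  assumes "(y, z) \<in> reach s p a i"
  shows "\<exists>c. c 0 = p \<and> c 1 = a \<and> c i = y \<and> c (Suc i) = z \<and>
    (\<forall>j\<in>{1..i}. f (s + j) (c (j - 1)) (c (Suc j)) \<noteq> c j)"
  using assms
proof (induction i arbitrary: y z)
  case 0
  then show ?case by (intro exI[of _ "\<lambda>j. if j = 0 then p else a"]) auto
next
  case (Suc i)
  then obtain x where x: "(x, y) \<in> reach s p a i" "f (s + Suc i) x z \<noteq> y" by auto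
  from Suc.IH[OF x(1)] obtain c where c: "c 0 = p" "c 1 = a" "c i = x" "c (Suc i) = y"
    "\<And>j. j \<in> {1..i} \<Longrightarrow> f (s + j) (c (j - 1)) (c (Suc j)) \<noteq> c j" by blast
  let ?c = "c(Suc (Suc i) := z)"
  have "f (s + j) (?c (j - 1)) (?c (Suc j)) \<noteq> ?c j" if "j \<in> {1..Suc i}" for j
    using that c(3,4) c(5)[of j] x(2) by (cases "j = Suc i") auto
  then show ?case using c by (intro exI[of _ ?c]) auto
qed

text \<open>Closing the sequence up gives a placement on which the sages \<open>s + 1\<close> to
  \<open>s + n - 1\<close> are wrong, so sage \<open>s + n\<close>, that is \<open>s\<close>, must
  be right.\<close>

lemma reach_closed:
  assumes "(z, p) \<in> reach s p a (n - 1)"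
  shows "f s z a = p"
proof -
  obtain c where c: "c 0 = p" "c 1 = a" "c (n - 1) = z" "c n = p"
    "\<And>j. j \<in> {1..n - 1} \<Longrightarrow> f (s + j) (c (j - 1)) (c (Suc j)) \<noteq> c j"
    using reach_sequence[OF assms] n by auto
  let ?c = "c(Suc n := a)"
  obtain i where i: "i \<in> {1..n}" "f (s + i) (?c (i - 1)) (?c (Suc i)) = ?c i"
    using wins[of ?c s] c n by auto
  have "i = n"
  proof (rule ccontr)
    assume "i \<noteq> n"
    then have "i \<in> {1..n - 1}" using i by auto
    moreover have "?c (i - 1) = c (i - 1)" "?c (Suc i) = c (Suc i)" "?c i = c i"
      using i(1) \<open>i \<noteq> n\<close> by auto
    ultimately show False using c(5)[of i] i(2) by simp
  qed
  moreover have "?c (n - 1) = c (n - 1)" using n by auto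
  ultimately show ?thesis using i(2) c(3,4) periodic[of s] by simp
qed

text \<open>A \<open>fork\<close> has two possible last hats after the same hat; a
  \<open>broad\<close> set has two possible hats before every last hat. Both persist, and on closing
  they yield one and two backward kills respectively.\<close>

definition fork :: "nat \<Rightarrow> hat \<Rightarrow> hat \<Rightarrow> nat \<Rightarrow> bool" where
  "fork s p a i \<longleftrightarrow> (\<exists>y z z'. z \<noteq> z' \<and> (y, z) \<in> reach s p a i \<and> (y, z') \<in> reach s p a i)"

definition broad :: "nat \<Rightarrow> hat \<Rightarrow> hat \<Rightarrow> nat \<Rightarrow> bool" where
  "broad s p a i \<longleftrightarrow> (\<forall>w. \<exists>z z'. z \<noteq> z' \<and> (z, w) \<in> reach s p a i \<and> (z', w) \<in> reach s p a i)"

text \<open>The single guess \<open>f (s + Suc i) y w\<close> cannot equal both \<open>z\<close> and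
  \<open>z'\<close>.\<close>

lemma fork_extend:
  assumes "z \<noteq> z'" "(y, z) \<in> reach s p a i" "(y, z') \<in> reach s p a i"
  shows "(z, w) \<in> reach s p a (Suc i) \<or> (z', w) \<in> reach s p a (Suc i)"
  using assms by auto

lemma fork_step:
  assumes "fork s p a i"
  shows "fork s p a (Suc i)"
proof -
  obtain y z z' where "z \<noteq> z'" "(y, z) \<in> reach s p a i" "(y, z') \<in> reach s p a i"
    using assms by (auto simp: fork_def)
  note ext = fork_extend[OF this]
  \<comment> \<open>Of the three hats \<open>w\<close>, two continue the same one of
    \<open>z\<close> and \<open>z'\<close>; this is the new fork.\<close>
  from hat_pigeonhole[of "\<lambda>w. (z, w) \<in> reach s p a (Suc i)", OF ext]
  show ?thesis unfolding fork_def by blast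
qed

lemma fork_later: "fork s p a i \<Longrightarrow> i \<le> j \<Longrightarrow> fork s p a j"
  by (rotate_tac, induction j rule: dec_induct) (simp, rule fork_step)

lemma fork_closes:
  assumes "fork s p a i" "i \<le> n - 2"
  shows "\<exists>z. f s z a = p"
proof -
  obtain y z z' where "z \<noteq> z'" "(y, z) \<in> reach s p a (n - 2)" "(y, z') \<in> reach s p a (n - 2)"
    using fork_later[OF assms] by (auto simp: fork_def)
  from fork_extend[OF this, of p] have "\<exists>z. (z, p) \<in> reach s p a (Suc (n - 2))" by blast
  moreover have "Suc (n - 2) = n - 1" using n by simp
  ultimately obtain z where "(z, p) \<in> reach s p a (n - 1)" by auto
  then show ?thesis using reach_closed by blast
qed

lemma broad_step:
  assumes "broad s p a i"
  shows "broad s p a (Suc i)"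
  unfolding broad_def
proof
  fix e
  have "cnt (\<lambda>d. (d, e) \<notin> reach s p a (Suc i)) \<le> 1"
  proof (rule ccontr)
    assume "\<not> ?thesis"
    then have "2 \<le> cnt (\<lambda>d. (d, e) \<notin> reach s p a (Suc i))" by linarith
    \<comment> \<open>Two excluded hats \<open>d\<close> and \<open>d'\<close> would each need two
      predecessors with that guess, hence four different hats.\<close>
    from cnt_ge_2_ex[OF this] obtain d d' where d: "d \<noteq> d'" "(d, e) \<notin> reach s p a (Suc i)" "(d', e) \<notin> reach s p a (Suc i)"
      by blast
    obtain c1 c2 where c: "c1 \<noteq> c2" "(c1, d) \<in> reach s p a i" "(c2, d) \<in> reach s p a i"
      using assms unfolding broad_def by blast
    obtain c3 c4 where c': "c3 \<noteq> c4" "(c3, d') \<in> reach s p a i" "(c4, d') \<in> reach s p a i"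
      using assms unfolding broad_def by blast
    have "f (s + Suc i) c1 e = d" "f (s + Suc i) c2 e = d"
      "f (s + Suc i) c3 e = d'" "f (s + Suc i) c4 e = d'"
      using c c' d(2,3) by auto
    then have "c1 \<noteq> c3" "c1 \<noteq> c4" "c2 \<noteq> c3" "c2 \<noteq> c4" using d(1) by auto
    then show False using c(1) c'(1) by (cases c1; cases c2; cases c3; cases c4) auto
  qed
  then obtain z z' where "z \<noteq> z'" "\<not> (z, e) \<notin> reach s p a (Suc i)" "\<not> (z', e) \<notin> reach s p a (Suc i)"
    by (rule cnt_le_1_ex)
  then show "\<exists>z z'. z \<noteq> z' \<and> (z, e) \<in> reach s p a (Suc i) \<and> (z', e) \<in> reach s p a (Suc i)"
    by blast
qed

lemma broad_later: "broad s p a i \<Longrightarrow> i \<le> j \<Longrightarrow> broad s p a j"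
  by (rotate_tac, induction j rule: dec_induct) (simp, rule broad_step)

lemma broad_closes:
  assumes "broad s p a i" "i \<le> n - 1"
  shows "2 \<le> cnt (\<lambda>z. f s z a = p)"
proof -
  obtain z z' where "z \<noteq> z'" "(z, p) \<in> reach s p a (n - 1)" "(z', p) \<in> reach s p a (n - 1)"
    using broad_later[OF assms] unfolding broad_def by blast
  then show ?thesis by (intro cnt_ge_2[of _ z z'] reach_closed)
qed

text \<open>For fixed outer hats \<open>y\<close> and \<open>w\<close>, the guess excludes only one
  of the three middle hats.\<close>

lemma broadI:
  assumes "\<And>b. (y, b) \<in> reach s p a i"
  shows "broad s p a (Suc i)"
  unfolding broad_def
proof
  fix w
  obtain z z' where "z \<noteq> z'" "f (s + Suc i) y w \<noteq> z" "f (s + Suc i) y w \<noteq> z'"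
    using two_other_hats by blast
  then show "\<exists>z z'. z \<noteq> z' \<and> (z, w) \<in> reach s p a (Suc i) \<and> (z', w) \<in> reach s p a (Suc i)"
    using assms by auto
qed

section \<open>Forward and backward kills of the states of an edge\<close>

definition kills :: "nat \<Rightarrow> hat \<Rightarrow> hat \<Rightarrow> nat" where
  "kills s p a = cnt (\<lambda>b. f (Suc s) p b = a)"

definition back_kills :: "nat \<Rightarrow> hat \<Rightarrow> hat \<Rightarrow> nat" where
  "back_kills s p a = cnt (\<lambda>z. f s z a = p)"

lemma kills_row: "kills s p H0 + kills s p H1 + kills s p H2 = 3"
  unfolding kills_def by (rule cnt_fibres)

lemma back_kills_column: "back_kills s H0 a + back_kills s H1 a + back_kills s H2 a = 3"
  unfolding back_kills_def by (rule cnt_fibres)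

text \<open>No forward kill leaves all three continuations, hence a broad set after one more step;
  one forward kill leaves two, hence a fork. Closing them takes two and one backward kills.\<close>

lemma kills_add_ge: "2 \<le> kills s p a + back_kills s p a"
proof -
  consider "kills s p a = 0" | "kills s p a = 1" | "2 \<le> kills s p a" by linarith
  then show ?thesis
  proof cases
    case 1
    then have "(a, b) \<in> reach s p a 1" for b
      using cnt_0[of "\<lambda>b. f (Suc s) p b = a"] by (auto simp: kills_def)
    then have "broad s p a (Suc 1)" by (rule broadI)
    then have "2 \<le> back_kills s p a"
      unfolding back_kills_def by (rule broad_closes) (use n in simp)
    then show ?thesis by simp
  next
    case 2
    then obtain b b' where "b \<noteq> b'" "f (Suc s) p b \<noteq> a" "f (Suc s) p b' \<noteq> a"
      using cnt_le_1_ex[of "\<lambda>b. f (Suc s) p b = a"] by (auto simp: kills_def)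
    then have "fork s p a 1" by (auto simp: fork_def)
    moreover have "1 \<le> n - 2" using n by simp
    ultimately obtain z where "f s z a = p" using fork_closes by blast
    then show ?thesis using cnt_pos[of "\<lambda>z. f s z a = p" z] 2 by (simp add: back_kills_def)
  qed simp
qed

text \<open>Both counts sum to 9 over all states of an edge, so the inequality above is tight everywhere.\<close>

lemma kills_add: "kills s p a + back_kills s p a = 2"
proof -
  have "\<forall>p a. kills s p a + back_kills s p a = 2"
    using kills_row[of s H0] kills_row[of s H1] kills_row[of s H2]
      back_kills_column[of s H0] back_kills_column[of s H1] back_kills_column[of s H2]
      kills_add_ge[of s H0 H0] kills_add_ge[of s H0 H1] kills_add_ge[of s H0 H2]
      kills_add_ge[of s H1 H0] kills_add_ge[of s H1 H1] kills_add_ge[of s H1 H2]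
      kills_add_ge[of s H2 H0] kills_add_ge[of s H2 H1] kills_add_ge[of s H2 H2]
    unfolding all_hat by (intro conjI; linarith)
  then show ?thesis by blast
qed

lemma kills_le_2: "kills s p a \<le> 2"
  using kills_add[of s p a] by linarith

text \<open>Together with \<open>kills_row\<close> and \<open>kills_le_2\<close>: each
  \<open>kills s\<close> is a matrix with entries at most 2 and all line sums 3.\<close>

lemma kills_column: "kills s H0 a + kills s H1 a + kills s H2 a = 3"
  using back_kills_column[of s a] kills_add[of s H0 a] kills_add[of s H1 a] kills_add[of s H2 a]
  by linarith

text \<open>Two forward kills mean no backward kill, so no fork may arise; a surviving successor
  with at most one kill would be a fork after two steps.\<close>

lemma kills_2_step:
  assumes "kills s p a = 2" "f (Suc s) p b \<noteq> a"
  shows "kills (Suc s) a b = 2"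
proof (rule ccontr)
  assume "kills (Suc s) a b \<noteq> 2"
  then have "kills (Suc s) a b \<le> 1" using kills_le_2[of "Suc s" a b] by linarith
  then obtain c c' where c: "c \<noteq> c'" "f (Suc (Suc s)) a c \<noteq> b" "f (Suc (Suc s)) a c' \<noteq> b"
    using cnt_le_1_ex[of "\<lambda>c. f (Suc (Suc s)) a c = b"] by (auto simp: kills_def)
  have "(a, b) \<in> reach s p a 1" using assms(2) by simp
  then have "(b, c) \<in> reach s p a (Suc 1)" "(b, c') \<in> reach s p a (Suc 1)" using c by auto
  then have "fork s p a 2" using c(1) unfolding fork_def numeral_2_eq_2 by auto
  moreover have "2 \<le> n - 2" using n by simp
  ultimately obtain z where "f s z a = p" using fork_closes by blast
  then have "1 \<le> back_kills s p a" unfolding back_kills_def by (rule cnt_pos)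
  then show False using kills_add[of s p a] assms(1) by simp
qed

text \<open>One forward kill means one backward kill, too few for a broad set. The four steps made
  here fit because \<open>n \<ge> 5\<close>.\<close>

lemma kills_1_no_broad:
  assumes "kills s p a = 1" "\<And>w. (y, w) \<in> reach s p a 3"
  shows False
proof -
  have "broad s p a (Suc 3)" by (rule broadI) (rule assms(2))
  then have "2 \<le> back_kills s p a"
    unfolding back_kills_def by (rule broad_closes) (use n in simp)
  then show False using kills_add[of s p a] assms(1) by simp
qed

lemma kills_periodic: "kills (s + n) = kills s"
  using periodic[of "Suc s"] by (simp add: kills_def fun_eq_iff)

lemma row_unique: "kills s p a = 2 \<Longrightarrow> kills s p a' = 2 \<Longrightarrow> a = a'"
  using kills_row[of s p] by (cases a; cases a') auto

lemma column_unique: "kills s p a = 2 \<Longrightarrow> kills s p' a = 2 \<Longrightarrow> p = p'"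
  using kills_column[of s a] by (cases p; cases p') auto

section \<open>Rows and columns of the kill matrices\<close>

definition full_row :: "nat \<Rightarrow> hat \<Rightarrow> bool" where
  "full_row s p \<longleftrightarrow> (\<exists>a. kills s p a = 2)"

definition full_column :: "nat \<Rightarrow> hat \<Rightarrow> bool" where
  "full_column s a \<longleftrightarrow> (\<exists>p. kills s p a = 2)"

text \<open>Three entries at most 2 with sum 3 and no entry 2 are all 1; a full row consists of 0, 1
  and 2.\<close>

lemma row_ones: "\<not> full_row s p \<Longrightarrow> kills s p a = 1"
  using kills_row[of s p] kills_le_2[of s p H0] kills_le_2[of s p H1] kills_le_2[of s p H2]
  by (cases a) (auto simp: full_row_def all_hat le_less)

lemma column_ones: "\<not> full_column s a \<Longrightarrow> kills s p a = 1"
  using kills_column[of s a] kills_le_2[of s H0 a] kills_le_2[of s H1 a] kills_le_2[of s H2 a]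
  by (cases p) (auto simp: full_column_def all_hat le_less)

lemma full_row_Suc: "full_column s a \<Longrightarrow> full_row (Suc s) a"
proof -
  assume "full_column s a"
  then obtain p where p: "kills s p a = 2" by (auto simp: full_column_def)
  then obtain b where "f (Suc s) p b \<noteq> a"
    using cnt_le_2_ex[of "\<lambda>b. f (Suc s) p b = a"] by (auto simp: kills_def)
  then show ?thesis using kills_2_step[OF p] by (auto simp: full_row_def)
qed

text \<open>A row or column with sum 3 has at most one entry 2, so both sides count these
  entries.\<close>

lemma cnt_full: "cnt (full_row s) = cnt (full_column s)"
proof -
  have "of_bool (full_row s p) = of_bool (kills s p H0 = 2) + of_bool (kills s p H1 = 2) +
      (of_bool (kills s p H2 = 2) :: nat)" for p
    using kills_row[of s p] by (auto simp: full_row_def all_hat of_bool_def)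
  moreover have "of_bool (full_column s a) = of_bool (kills s H0 a = 2) + of_bool (kills s H1 a = 2) +
      (of_bool (kills s H2 a = 2) :: nat)" for a
    using kills_column[of s a] by (auto simp: full_column_def all_hat of_bool_def)
  ultimately show ?thesis by (simp add: cnt_def)
qed

lemma cnt_full_row_Suc: "cnt (full_row s) \<le> cnt (full_row (Suc s))"
  unfolding cnt_full[of s] by (rule cnt_mono) (rule full_row_Suc)

text \<open>The count is monotone in \<open>s\<close> and returns to its initial value at multiples
  of \<open>n\<close>, one of which is \<open>s * n \<ge> s\<close>.\<close>

lemma cnt_full_row: "cnt (full_row s) = cnt (full_row 0)"
proof -
  have mono: "cnt (full_row s) \<le> cnt (full_row t)" if "s \<le> t" for s t
    using that by (induction t rule: dec_induct) (use cnt_full_row_Suc le_trans in blast)+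
  have "full_row (s * n) = full_row 0"
  proof (induction s)
    case (Suc s)
    have "full_row (s * n + n) = full_row (s * n)"
      by (simp add: full_row_def fun_eq_iff kills_periodic)
    then show ?case using Suc by (simp add: add.commute)
  qed simp
  moreover have "s \<le> s * n" using n by simp
  ultimately show ?thesis using mono[of 0 s] mono[of s "s * n"] by simp
qed

lemma full_column_if_row: "full_row (Suc s) a \<Longrightarrow> full_column s a"
proof -
  have "cnt (full_row (Suc s)) \<le> cnt (full_column s)"
    using cnt_full_row[of s] cnt_full_row[of "Suc s"] cnt_full[of s] by simp
  from cnt_mono_eq[OF _ this] show "full_row (Suc s) a \<Longrightarrow> full_column s a"
    using full_row_Suc by blast
qed

text \<open>Column \<open>q\<close> consists of ones, so some \<open>z\<close> makes the guess
  \<open>a\<close> before \<open>q\<close>. Were row \<open>z\<close> full, its entry 2 would lie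
  outside column \<open>a\<close>, survive to \<open>q\<close> and make column \<open>q\<close>
  full.\<close>

lemma ones_predecessor:
  assumes "\<not> full_column s a" "\<not> full_column (Suc s) q"
  shows "\<exists>z. \<not> full_row s z \<and> f (Suc s) z q = a"
proof -
  have "back_kills (Suc s) a q = 1"
    using column_ones[OF assms(2), of a] kills_add[of "Suc s" a q] by simp
  then obtain z where z: "f (Suc s) z q = a"
    using cnt_pos_ex[of "\<lambda>z. f (Suc s) z q = a"] by (auto simp: back_kills_def)
  have "\<not> full_row s z"
  proof
    assume "full_row s z"
    then obtain a' where a': "kills s z a' = 2" by (auto simp: full_row_def)
    then have "a' \<noteq> a" using assms(1) by (auto simp: full_column_def)
    then have "kills (Suc s) a' q = 2" using kills_2_step[OF a'] z by auto
    then show False using assms(2) by (auto simp: full_column_def)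
  qed
  then show ?thesis using z by blast
qed

text \<open>Otherwise every edge has a column of ones. Following these backwards gives
  \<open>p\<close>, \<open>a\<close>, \<open>b\<close>, \<open>c\<close> such that \<open>b\<close>
  is the only hat with guess \<open>a\<close> after \<open>p\<close>, and the guess between
  \<open>a\<close> and \<open>c\<close> is \<open>b\<close>. Then \<open>c\<close> is reached
  through both hats other than \<open>b\<close>, and for every next hat \<open>w\<close> one of
  these leaves \<open>c\<close> unguessed. So a state with one kill becomes broad.\<close>

lemma full_row: "full_row s p"
proof (rule ccontr)
  assume "\<not> full_row s p"
  then have "cnt (full_row s) \<le> 2" using cnt_le_2I by blast
  then have "cnt (full_column t) \<le> 2" for t
    using cnt_full_row[of s] cnt_full_row[of t] cnt_full[of t] by simp
  then have ex: "\<exists>x. \<not> full_column t x" for t using cnt_le_2_ex by blast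
  obtain c where c: "\<not> full_column (Suc (Suc s)) c" using ex by blast
  obtain b where b: "\<not> full_column (Suc s) b" using ex by blast
  obtain a where a: "\<not> full_row (Suc s) a" "f (Suc (Suc s)) a c = b"
    using ones_predecessor[OF b c] by blast
  then have "\<not> full_column s a" using full_row_Suc by blast
  then obtain p where p: "\<not> full_row s p" "f (Suc s) p b = a"
    using ones_predecessor b by blast
  have k1: "kills s p a = 1" using row_ones[OF p(1)] .
  have "(c, w) \<in> reach s p a 3" for w
  proof -
    have "\<not> full_row (Suc (Suc (Suc s))) c" using c full_column_if_row by blast
    then have bk: "back_kills (Suc (Suc (Suc s))) c w = 1"
      using row_ones kills_add[of "Suc (Suc (Suc s))" c w] by simp
    obtain x y where xy: "x \<noteq> y" "b \<noteq> x" "b \<noteq> y" using two_other_hats by blast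
    have "\<not> (f (Suc (Suc (Suc s))) x w = c \<and> f (Suc (Suc (Suc s))) y w = c)"
      using bk cnt_ge_2[of "\<lambda>z. f (Suc (Suc (Suc s))) z w = c" x y] xy(1) by (auto simp: back_kills_def)
    then obtain z where z: "b \<noteq> z" "f (Suc (Suc (Suc s))) z w \<noteq> c" using xy by blast
    have "f (Suc s) p z \<noteq> a"
      using k1 cnt_ge_2[of "\<lambda>x. f (Suc s) p x = a" b z] p(2) z(1) by (auto simp: kills_def)
    then have "(a, z) \<in> reach s p a 1" by simp
    then have "(z, c) \<in> reach s p a (Suc 1)" using a(2) z(1) by auto
    then have "(c, w) \<in> reach s p a (Suc (Suc 1))" using z(2) by auto
    then show ?thesis by (simp add: numeral_3_eq_3)
  qed
  then show False using kills_1_no_broad[OF k1] by blast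
qed

lemma full_column: "full_column s a"
  using full_column_if_row full_row by blast

text \<open>At level 1, the only backward kill of \<open>(y, w)\<close> comes from the hat
  \<open>z\<close> with \<open>(z, y)\<close> of level 2, and \<open>z\<close> differs from
  \<open>x\<close>. States of level 2 have no backward kill, those of level 0 no forward
  kill.\<close>

lemma level_valid:
  assumes "kills i x y = kills (Suc i) y w"
  shows "f (Suc i) x w \<noteq> y"
proof
  assume *: "f (Suc i) x w = y"
  then have "1 \<le> kills i x y" unfolding kills_def by (rule cnt_pos)
  then consider "kills i x y = 1" | "kills i x y = 2" using kills_le_2[of i x y] by linarith
  then show False
  proof cases
    case 1
    then have bk: "back_kills (Suc i) y w = 1" using assms kills_add[of "Suc i" y w] by simp
    obtain z where z: "kills i z y = 2" using full_column[of i y] by (auto simp: full_column_def)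
    have "f (Suc i) z w = y" using kills_2_step[OF z, of w] assms 1 by auto
    moreover have "z \<noteq> x" using z 1 by auto
    ultimately have "2 \<le> back_kills (Suc i) y w"
      unfolding back_kills_def using * by (intro cnt_ge_2)
    then show False using bk by simp
  next
    case 2
    then have "back_kills (Suc i) y w = 0" using assms kills_add[of "Suc i" y w] by simp
    then show False using cnt_0[of "\<lambda>z. f (Suc i) z w = y"] * by (auto simp: back_kills_def)
  qed
qed

lemma no_level_loop:
  assumes "c n = c 0" "c (Suc n) = c 1" "\<And>i. kills i (c i) (c (Suc i)) = k"
  shows False
proof -
  obtain i where i: "i \<in> {1..n}" "f i (c (i - 1)) (c (Suc i)) = c i"
    using wins[OF assms(1,2), of 0] by auto
  then obtain j where "i = Suc j" by (cases i) auto
  then show False using level_valid[of j "c j" "c (Suc j)" "c (Suc (Suc j))"] assms(3) i(2) by simp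
qed

section \<open>Labels transported along level 2, and the closing of levels\<close>

definition nxt :: "nat \<Rightarrow> hat \<Rightarrow> hat" where
  "nxt s p = (THE a. kills s p a = 2)"

lemma kills_nxt: "kills s p (nxt s p) = 2"
proof -
  obtain a where a: "kills s p a = 2" using full_row[of s p] by (auto simp: full_row_def)
  then have "nxt s p = a" unfolding nxt_def by (rule the_equality) (rule row_unique[OF _ a])
  then show ?thesis using a by simp
qed

lemma nxt_inj: "nxt s p = nxt s q \<Longrightarrow> p = q"
  using kills_nxt[of s p] kills_nxt[of s q] column_unique[of s p "nxt s p" q] by simp

text \<open>Labels the hats of sage \<open>i\<close> by hats of sage \<open>0\<close>, so that level
  2 joins equal labels on every edge.\<close>

primrec chain :: "hat \<Rightarrow> nat \<Rightarrow> hat" where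
  "chain l 0 = l"
| "chain l (Suc i) = nxt i (chain l i)"

lemma chain_inj: "chain l i = chain m i \<Longrightarrow> l = m"
  by (induction i) (auto dest: nxt_inj)

lemma chain_shift: "chain l (i + n) = chain (chain l n) i"
proof (induction i)
  case (Suc i)
  have "nxt (i + n) = nxt i" by (simp add: nxt_def fun_eq_iff kills_periodic)
  then show ?case using Suc by simp
qed simp

lemma sum_rotations:
  fixes g :: "hat \<Rightarrow> nat"
  assumes "\<And>l m. h l = h m \<Longrightarrow> l = m"
  shows "g (h l) + g (h (rot l)) + g (h (rot (rot l))) = g H0 + g H1 + g H2"
proof -
  have "h l \<noteq> h (rot l)" "h l \<noteq> h (rot (rot l))" "h (rot l) \<noteq> h (rot (rot l))"
    using assms by (metis rot_neq(1) rot_neq(3) rot_neq(2))+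
  then show ?thesis by (cases "h l"; cases "h (rot l)"; cases "h (rot (rot l))") auto
qed

text \<open>Rows and columns have sum 3, of which equal labels account for 2.\<close>

lemma level_rotations:
  "kills i (chain l i) (chain (rot l) (Suc i)) + kills i (chain l i) (chain (rot (rot l)) (Suc i)) = 1"
  "kills i (chain (rot l) i) (chain l (Suc i)) + kills i (chain (rot (rot l)) i) (chain l (Suc i)) = 1"
  using sum_rotations[of "\<lambda>l. chain l (Suc i)" "kills i (chain l i)" l, OF chain_inj[of _ "Suc i"]]
    sum_rotations[of "\<lambda>l. chain l i" "\<lambda>x. kills i x (chain l (Suc i))" l, OF chain_inj[of _ i]]
    kills_row[of i "chain l i"] kills_column[of i "chain l (Suc i)"] kills_nxt[of i "chain l i"]
  by simp_all

text \<open>\<open>rot\<close> or its inverse: level 1 may shift labels either way, and both ways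
  are treated at once.\<close>

definition rotation :: "(hat \<Rightarrow> hat) \<Rightarrow> bool" where
  "rotation r \<longleftrightarrow> r = rot \<or> r = (\<lambda>l. rot (rot l))"

lemma rotation_cube: "rotation r \<Longrightarrow> r (r (r l)) = l"
  by (auto simp: rotation_def)

lemma rotation_funpow: "rotation r \<Longrightarrow> 3 dvd k \<Longrightarrow> (r ^^ k) l = l"
proof -
  assume r: "rotation r"
  have "(r ^^ (3 * j)) l = l" for j
    by (induction j) (simp_all add: numeral_3_eq_3 rotation_cube[OF r])
  then show "3 dvd k \<Longrightarrow> (r ^^ k) l = l" by (auto elim!: dvdE)
qed

lemma inj_hat_range:
  assumes "rotation r" "\<And>l m. h l = h m \<Longrightarrow> l = m"
  shows "y = h m \<or> y = h (r m) \<or> y = (h (r (r m)) :: hat)"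
proof -
  have "m \<noteq> r m" "m \<noteq> r (r m)" "r m \<noteq> r (r m)" using assms(1) by (auto simp: rotation_def)
  then have "h m \<noteq> h (r m)" "h m \<noteq> h (r (r m))" "h (r m) \<noteq> h (r (r m))"
    using assms(2)[of m "r m"] assms(2)[of m "r (r m)"] assms(2)[of "r m" "r (r m)"] by blast+
  then show ?thesis
    by (cases y; cases "h m"; cases "h (r m)"; cases "h (r (r m))") simp_all
qed

lemma derangement_rotation:
  assumes "rotation r" "\<And>l m. h l = h m \<Longrightarrow> l = m" "\<And>l. h l \<noteq> l"
  shows "(\<forall>l. h l = r l) \<or> (\<forall>l. h l = r (r l))"
proof -
  have "h H0 \<noteq> h H1" "h H0 \<noteq> h H2" "h H1 \<noteq> h H2"
    using assms(2)[of H0 H1] assms(2)[of H0 H2] assms(2)[of H1 H2] by blast+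
  then have "(\<forall>l. h l = rot l) \<or> (\<forall>l. h l = rot (rot l))"
    unfolding all_hat using assms(3)[of H0] assms(3)[of H1] assms(3)[of H2]
    by (cases "h H0"; cases "h H1"; cases "h H2") simp_all
  then show ?thesis using assms(1) by (auto simp: rotation_def)
qed

definition oriented :: "(hat \<Rightarrow> hat) \<Rightarrow> nat \<Rightarrow> bool" where
  "oriented r i \<longleftrightarrow> (\<forall>l. kills i (chain l i) (chain (r l) (Suc i)) = 1)"

lemma oriented_0:
  assumes "oriented r i" "rotation r"
  shows "kills i (chain l i) (chain (r (r l)) (Suc i)) = 0"
  using level_rotations(1)[of i l] assms by (auto simp: oriented_def rotation_def simp del: chain.simps)

lemma oriented_exists: "\<exists>r. rotation r \<and> oriented r i"
proof -
  define k where "k l m = kills i (chain l i) (chain m (Suc i))" for l m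
  \<comment> \<open>Off the diagonal, each row and column contains one 0 and one 1, so the ones form
    one of the two cyclic permutations.\<close>
  have "(\<forall>l. k l (rot l) = 1) \<or> (\<forall>l. k l (rot (rot l)) = 1)"
    using level_rotations(1)[of i H0, folded k_def] level_rotations(1)[of i H1, folded k_def]
      level_rotations(1)[of i H2, folded k_def] level_rotations(2)[of i H0, folded k_def]
      level_rotations(2)[of i H1, folded k_def] level_rotations(2)[of i H2, folded k_def]
    unfolding all_hat by (cases "k H0 H1 = 0") auto
  then show ?thesis
  proof
    assume "\<forall>l. k l (rot l) = 1"
    then show ?thesis by (intro exI[of _ rot]) (simp add: rotation_def oriented_def k_def del: chain.simps)
  next
    assume "\<forall>l. k l (rot (rot l)) = 1"
    then show ?thesis
      by (intro exI[of _ "\<lambda>l. rot (rot l)"]) (simp add: rotation_def oriented_def k_def del: chain.simps)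
  qed
qed

text \<open>
  The guess of a sage between two hats of equal label is neither of level 2 nor of level 0, so it has
  level 1 and leads to a state of level 0.
\<close>

lemma oriented_Suc:
  assumes r: "rotation r" and o: "oriented r i"
  shows "oriented r (Suc i)"
  unfolding oriented_def
proof
  fix l
  define m where "m = r (r l)"
  have rm: "r m = l" "r (r m) = r l" using rotation_cube[OF r] by (simp_all add: m_def)
  define x w where "x = chain m i" and "w = chain m (Suc (Suc i))"
  define b where "b = f (Suc i) x w"
  have "b \<noteq> chain m (Suc i)"
    using level_valid[of i x "chain m (Suc i)" w] kills_nxt by (simp add: x_def w_def b_def)
  moreover have "b \<noteq> chain (r (r m)) (Suc i)"
    using oriented_0[OF o r, of m] cnt_0[of "\<lambda>b'. f (Suc i) x b' = chain (r (r m)) (Suc i)" w]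
    by (auto simp: kills_def x_def b_def simp del: chain.simps)
  ultimately have "b = chain l (Suc i)"
    using inj_hat_range[of r "\<lambda>l. chain l (Suc i)" b m, OF r chain_inj[of _ "Suc i"]] rm by auto
  moreover have "kills i x (chain l (Suc i)) = 1"
    using o rm unfolding oriented_def x_def by metis
  ultimately have "kills (Suc i) (chain l (Suc i)) (chain (r (r l)) (Suc (Suc i))) \<noteq> 1"
    using level_valid[of i x "chain l (Suc i)" w] unfolding b_def w_def m_def by auto
  then show "kills (Suc i) (chain l (Suc i)) (chain (r l) (Suc (Suc i))) = 1"
    using level_rotations(1)[of "Suc i" l] r by (auto simp: rotation_def simp del: chain.simps)
qed

text \<open>Going round once at level 2 permutes the labels without fixed points, hence acts as
  \<open>r ^^ t\<close> with \<open>t\<close> 1 or 2. Level 1 adds a shift \<open>r\<close> per edge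
  and level 0 a shift \<open>r ^^ 2\<close>, so they close up if 3 divides \<open>t + n\<close> or
  \<open>t + 2 * n\<close> respectively. One of these holds unless 3 divides
  \<open>n\<close>.\<close>

theorem dvd_length: "3 dvd n"
proof (rule ccontr)
  assume n3: "\<not> 3 dvd n"
  obtain r where r: "rotation r" and o: "oriented r 0" using oriented_exists by blast
  have or: "oriented r i" for i by (induction i) (use o oriented_Suc[OF r] in auto)
  have shift: "chain l (Suc n) = chain (chain l n) 1" for l
    using chain_shift[of l 1] by simp
  have "chain l n \<noteq> l" for l
  proof
    assume l: "chain l n = l"
    then have "chain l (Suc n) = chain l 1" using shift[of l] by simp
    then show False using no_level_loop[of "chain l" 2] l kills_nxt by auto
  qed
  from derangement_rotation[OF r chain_inj[of _ n] this]
  obtain t where t: "t = 1 \<or> t = 2" "\<And>l. chain l n = (r ^^ t) l"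
    by (metis funpow_0 funpow.simps(2) comp_apply numeral_2_eq_2 One_nat_def)
  have "3 dvd t + 1 * n \<or> 3 dvd t + 2 * n" using n3 t(1) by presburger
  then obtain j where j: "j = 1 \<or> j = 2" "3 dvd t + j * n" by blast
  \<comment> \<open>\<open>j = 1\<close> follows level 1, \<open>j = 2\<close> follows level
    0.\<close>
  define c where "c i = chain ((r ^^ (j * i)) H0) i" for i
  have "c n = (r ^^ (t + j * n)) H0" by (simp add: c_def t(2) funpow_add)
  then have "c n = c 0" using rotation_funpow[OF r j(2)] by (simp add: c_def)
  moreover have "c (Suc n) = c 1"
  proof -
    have "c (Suc n) = chain ((r ^^ (t + j * Suc n)) H0) 1"
      by (simp only: c_def shift t(2) funpow_add comp_apply)
    also have "t + j * Suc n = j + (t + j * n)" by simp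
    also have "(r ^^ (j + (t + j * n))) H0 = (r ^^ j) ((r ^^ (t + j * n)) H0)"
      by (simp only: funpow_add comp_apply)
    finally show ?thesis using rotation_funpow[OF r j(2)] by (simp add: c_def del: chain.simps)
  qed
  moreover have "kills i (c i) (c (Suc i)) = (if j = 1 then 1 else 0)" for i
  proof -
    have "c (Suc i) = chain ((r ^^ j) ((r ^^ (j * i)) H0)) (Suc i)"
      by (simp add: c_def funpow_add del: chain.simps)
    then show ?thesis
      using j(1) or[of i] oriented_0[OF or[of i] r, of "(r ^^ (j * i)) H0"]
      by (auto simp: c_def oriented_def numeral_2_eq_2 simp del: chain.simps)
  qed
  ultimately show False by (rule no_level_loop)
qed

end

section \<open>Cores and unicyclic graphs\<close>

definition cycle_of :: "(nat \<Rightarrow> 'a) \<Rightarrow> nat \<Rightarrow> 'a set set" where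
  "cycle_of c n = (\<lambda>i. {c i, c (Suc i)}) ` {0..<n}"

lemma Union_cycle_of:
  assumes "circuit N c n"
  shows "\<Union>(cycle_of c n) = c ` {0..<n}"
proof
  have n: "3 \<le> n" "c n = c 0" using assms by (auto simp: circuit_def)
  have "c (Suc i) \<in> c ` {0..<n}" if "i < n" for i
  proof (cases "Suc i = n")
    case True
    then show ?thesis using n by auto
  qed (use that in auto)
  then show "\<Union>(cycle_of c n) \<subseteq> c ` {0..<n}" by (auto simp: cycle_of_def)
  show "c ` {0..<n} \<subseteq> \<Union>(cycle_of c n)" by (auto simp: cycle_of_def)
qed

lemma image_nth: "(!) xs ` {0..<length xs} = set xs"
  by (simp add: nth_image)

lemma pcas_verts: "pcas u p v \<Longrightarrow> pawalk_verts u p = u # map snd p"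
  by (induction p arbitrary: u) auto

lemma pcas_fst: "pcas u p v \<Longrightarrow> i < length p \<Longrightarrow> fst (p ! i) = (u # map snd p) ! i"
  by (induction p arbitrary: u i) (auto simp: nth_Cons split: nat.splits)

lemma pcas_last: "pcas u p v \<Longrightarrow> p \<noteq> [] \<Longrightarrow> snd (last p) = v"
  by (induction p arbitrary: u) auto

lemma graph_cycle_circuit:
  assumes "pair_graph G" "graph_cycle G p"
  obtains c where "circuit (neighbours G) c (length p)" "cycle_of c (length p) = cycle_edges p"
    "\<And>i. c (i mod length p) = c i"
proof
  interpret pair_graph G by fact
  let ?n = "length p"
  \<comment> \<open>\<open>c i\<close> is the head of arc \<open>i\<close> modulo the length, so arc
    \<open>Suc i\<close> runs from \<open>c i\<close> to \<open>c (Suc i)\<close>.\<close>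
  define c where "c i = snd (p ! (i mod ?n))" for i
  have n: "3 \<le> ?n" using assms(2) by (simp add: graph_cycle_def)
  then have pos: "0 < ?n" by linarith
  obtain u where u: "awalk u p u" "distinct (tl (pawalk_verts u p))"
    using assms(2) by (auto simp: graph_cycle_def cycle_def)
  then have cas: "pcas u p u" and arcs: "set p \<subseteq> parcs G" by (auto simp: awalk_def)
  have dist: "distinct (map snd p)" using u(2) pcas_verts[OF cas] by simp
  have arc: "p ! (Suc i mod ?n) = (c i, c (Suc i))" for i
  proof -
    have m: "Suc i mod ?n < ?n" using pos by simp
    have "fst (p ! (Suc i mod ?n)) = c i"
    proof (cases "Suc (i mod ?n) = ?n")
      case True
      then have "Suc i mod ?n = 0" by (simp add: mod_Suc)
      moreover have "i mod ?n = ?n - 1" using True by simp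
      ultimately show ?thesis
        using pcas_fst[OF cas, of 0] pcas_last[OF cas] pos by (auto simp: c_def last_conv_nth)
    next
      case False
      then have "Suc i mod ?n = Suc (i mod ?n)" by (simp add: mod_Suc)
      then show ?thesis using pcas_fst[OF cas m] m by (simp add: c_def)
    qed
    then show ?thesis by (simp add: c_def prod_eq_iff)
  qed
  have "walk (neighbours G) c ?n"
    unfolding walk_def
  proof (intro allI impI)
    fix i assume "i < ?n"
    have "p ! (Suc i mod ?n) \<in> parcs G" using n
      by (intro subsetD[OF arcs] nth_mem mod_less_divisor) linarith
    then have "(c i, c (Suc i)) \<in> parcs G" by (simp only: arc)
    then show "c (Suc i) \<in> neighbours G (c i) \<and> c i \<in> neighbours G (c (Suc i))"
      using arcs_symmetric by (auto simp: neighbours_def)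
  qed
  moreover have "inj_on c {0..<?n}"
    using nth_eq_iff_index_eq[OF dist] by (auto simp: inj_on_def c_def)
  ultimately show "circuit (neighbours G) c ?n" using n by (simp add: circuit_def c_def)
  show "cycle_of c ?n = cycle_edges p"
  proof -
    have "(\<lambda>i. Suc i mod ?n) ` {0..<?n} = {0..<?n}"
    proof
      show "{0..<?n} \<subseteq> (\<lambda>i. Suc i mod ?n) ` {0..<?n}"
      proof
        fix j assume j: "j \<in> {0..<?n}"
        show "j \<in> (\<lambda>i. Suc i mod ?n) ` {0..<?n}"
        proof (cases j)
          case 0
          moreover have "Suc (?n - 1) = ?n" using n by linarith
          ultimately show ?thesis using j by (intro image_eqI[of _ _ "?n - 1"]) auto
        next
          case (Suc k)
          then show ?thesis using j by (intro image_eqI[of _ _ k]) auto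
        qed
      qed
    qed (use pos in auto)
    then have "set p = (\<lambda>i. p ! (Suc i mod ?n)) ` {0..<?n}"
      using image_image[of "(!) p" "\<lambda>i. Suc i mod ?n" "{0..<?n}"] by (simp add: image_nth)
    then show ?thesis unfolding cycle_of_def cycle_edges_def by (simp add: arc image_image)
  qed
  show "c (i mod ?n) = c i" for i by (simp add: c_def)
qed

lemma pcas_map:
  "pcas (c k) (map (\<lambda>i. (c i, c (Suc i))) [k..<k + m]) (c (k + m))"
proof (induction m arbitrary: k)
  case (Suc m)
  have "[k..<k + Suc m] = k # [Suc k..<Suc k + m]" by (simp add: upt_conv_Cons)
  then show ?case using Suc[of "Suc k"] by simp
qed simp

lemma circuit_graph_cycle:
  assumes "pair_graph G" "circuit (neighbours G) c n"
  obtains p where "graph_cycle G p" "length p = n" "cycle_edges p = cycle_of c n"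
proof
  interpret pair_graph G by fact
  let ?p = "map (\<lambda>i. (c i, c (Suc i))) [0..<n]"
  have n: "3 \<le> n" "walk (neighbours G) c n" "inj_on c {0..<n}" "c n = c 0"
    using assms(2) by (auto simp: circuit_def)
  have cas: "pcas (c 0) ?p (c 0)" using pcas_map[of c 0 n] n by simp
  have arcs: "set ?p \<subseteq> parcs G" using walkD(1)[OF n(2)] by (auto simp: neighbours_def)
  have "c 0 \<in> pverts G"
    using walkD(1)[OF n(2), of 0] n(1) by (auto simp: neighbours_def dest: in_arcsD1)
  then have "awalk (c 0) ?p (c 0)" using cas arcs by (simp add: awalk_def)
  moreover have "distinct (tl (pawalk_verts (c 0) ?p))"
  proof -
    have "map snd ?p = map c [Suc 0..<Suc n]" by (simp add: map_Suc_upt[symmetric] comp_def del: upt_Suc)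
    moreover have "inj_on c {Suc 0..<Suc n}"
    proof (rule inj_onI)
      fix i j assume ij: "i \<in> {Suc 0..<Suc n}" "j \<in> {Suc 0..<Suc n}" "c i = c j"
      have "c (i mod n) = c (j mod n)"
        using ij n(4) by (cases "i = n"; cases "j = n") (auto simp: less_Suc_eq)
      then have "i mod n = j mod n" using n(1) by (intro inj_onD[OF n(3)]) auto
      then show "i = j" using ij by (cases "i = n"; cases "j = n") (auto simp: less_Suc_eq)
    qed
    ultimately show ?thesis using pcas_verts[OF cas] by (simp add: distinct_map del: upt_Suc)
  qed
  ultimately show "graph_cycle G ?p"
    using n(1) by (auto simp: graph_cycle_def cycle_def)
  show "length ?p = n" by simp
  show "cycle_edges ?p = cycle_of c n"
    by (auto simp: cycle_edges_def cycle_of_def image_image)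
qed

section \<open>Deleting leaves\<close>

lemma majority_hat:
  fixes g :: "hat \<Rightarrow> hat"
  assumes "(if g H0 = g H1 then g H0 else g H2) \<noteq> y"
  obtains c where "c \<noteq> h" "g c \<noteq> y"
proof -
  \<comment> \<open>A wrong majority means that at most one hat has \<open>g\<close>-value
    \<open>y\<close>, so two hats remain, one of which is not \<open>h\<close>.\<close>
  have "\<exists>c. c \<noteq> h \<and> g c \<noteq> y"
    using assms by (cases h) (auto split: if_splits)
  then show thesis using that by blast
qed

lemma forces_remove_leaf:
  fixes N :: "'a \<Rightarrow> 'a set"
  assumes win: "forces (\<lambda>v. N v \<inter> W) W (\<lambda>_. False)" and x: "x \<in> W"
    and sym: "\<And>u v. u \<in> N v \<Longrightarrow> v \<in> N u" and irrefl: "\<And>v. v \<notin> N v"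
    and leaf: "\<And>a b. a \<in> N x \<inter> W \<Longrightarrow> b \<in> N x \<inter> W \<Longrightarrow> a = b"
  shows "forces (\<lambda>v. N v \<inter> (W - {x})) (W - {x}) (\<lambda>_. False)"
proof -
  obtain F :: "'a \<Rightarrow> ('a \<Rightarrow> hat) \<Rightarrow> hat" where
    F: "\<forall>v\<in>W. \<forall>C C'. (\<forall>u\<in>N v \<inter> W. C u = C' u) \<longrightarrow> F v C = F v C'"
      "\<forall>C. (\<forall>v\<in>W. F v C \<noteq> C v) \<longrightarrow> False"
    using win by (rule forcesE)
  define F' where "F' v C = (if F v (C(x := H0)) = F v (C(x := H1)) then F v (C(x := H0))
      else F v (C(x := H2)))" for v C
  show ?thesis
  proof (rule forcesI[where F = F'])
    fix v and C C' :: "'a \<Rightarrow> hat"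
    assume v: "v \<in> W - {x}" and *: "\<And>u. u \<in> N v \<inter> (W - {x}) \<Longrightarrow> C u = C' u"
    have "F v (C(x := c)) = F v (C'(x := c))" for c
      by (rule F(1)[rule_format]) (use v * in auto)
    then show "F' v C = F' v C'" by (simp add: F'_def)
  next
    fix C :: "'a \<Rightarrow> hat" assume wrong: "\<And>v. v \<in> W - {x} \<Longrightarrow> F' v C \<noteq> C v"
    have indep: "F v (C(x := c)) = F v (C(x := H0))" if "v \<in> W" "x \<notin> N v" for v c
      by (rule F(1)[rule_format]) (use that in auto)
    define h where "h = F x (C(x := H0))"
    \<comment> \<open>The hat of \<open>x\<close> must avoid his own guess \<open>h\<close>, which
      does not depend on it, and keep his neighbour wrong.\<close>
    have "\<exists>c. c \<noteq> h \<and> (\<forall>v\<in>N x \<inter> W. F v (C(x := c)) \<noteq> C v)"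
    proof (cases "N x \<inter> W = {}")
      case True
      then show ?thesis using two_other_hats[of h] by auto
    next
      case False
      then obtain u where u: "u \<in> N x \<inter> W" by blast
      then have "u \<noteq> x" using irrefl by blast
      then have "F' u C \<noteq> C u" using wrong u by blast
      then obtain c where "c \<noteq> h" "F u (C(x := c)) \<noteq> C u"
        using majority_hat[of "\<lambda>c. F u (C(x := c))" "C u" h] unfolding F'_def by metis
      then show ?thesis using leaf[OF u] by blast
    qed
    then obtain c where c: "c \<noteq> h" "\<And>v. v \<in> N x \<inter> W \<Longrightarrow> F v (C(x := c)) \<noteq> C v" by blast
    have "F v (C(x := c)) \<noteq> (C(x := c)) v" if v: "v \<in> W" for v
    proof -
      consider "v = x" | "v \<noteq> x" "v \<in> N x" | "v \<noteq> x" "v \<notin> N x" by blast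
      then show ?thesis
      proof cases
        case 1
        then show ?thesis using indep[OF x irrefl, of c] c(1) by (simp add: h_def)
      next
        case 2
        then show ?thesis using c(2) v by simp
      next
        case 3
        then have "x \<notin> N v" using sym by blast
        then show ?thesis using indep[OF v, of c] indep[OF v, of H1] wrong[of v] 3 v by (simp add: F'_def)
      qed
    qed
    then show False using F(2) by blast
  qed
qed

lemma forces_core:
  assumes "finite V" "forces (\<lambda>v. N v \<inter> V) V (\<lambda>_. False)"
    and sym: "\<And>u v. u \<in> N v \<Longrightarrow> v \<in> N u" and irrefl: "\<And>v. v \<notin> N v"
  shows "\<exists>W\<subseteq>V. forces (\<lambda>v. N v \<inter> W) W (\<lambda>_. False) \<and>
    (\<forall>x\<in>W. \<exists>a b. a \<noteq> b \<and> a \<in> N x \<inter> W \<and> b \<in> N x \<inter> W)"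
  using assms(1,2)
proof (induction V rule: finite_psubset_induct)
  case (psubset V)
  show ?case
  proof (cases "\<forall>x\<in>V. \<exists>a b. a \<noteq> b \<and> a \<in> N x \<inter> V \<and> b \<in> N x \<inter> V")
    case True
    then show ?thesis using psubset.prems by blast
  next
    case False
    then obtain x where x: "x \<in> V" and leaf: "\<And>a b. a \<in> N x \<inter> V \<Longrightarrow> b \<in> N x \<inter> V \<Longrightarrow> a = b" by blast
    have "forces (\<lambda>v. N v \<inter> (V - {x})) (V - {x}) (\<lambda>_. False)"
      using psubset.prems x sym irrefl leaf by (rule forces_remove_leaf)
    moreover have "V - {x} \<subset> V" using x by blast
    ultimately obtain W where "W \<subseteq> V - {x}" "forces (\<lambda>v. N v \<inter> W) W (\<lambda>_. False)"
      "\<forall>x\<in>W. \<exists>a b. a \<noteq> b \<and> a \<in> N x \<inter> W \<and> b \<in> N x \<inter> W"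
      using psubset.IH by meson
    then show ?thesis by (intro exI[of _ W]) auto
  qed
qed

section \<open>Longest paths and the circuits that close them\<close>

definition path_in :: "('a \<Rightarrow> 'a set) \<Rightarrow> 'a set \<Rightarrow> 'a list \<Rightarrow> bool" where
  "path_in N W vs \<longleftrightarrow> vs \<noteq> [] \<and> distinct vs \<and> set vs \<subseteq> W \<and>
    (\<forall>i. Suc i < length vs \<longrightarrow> vs ! Suc i \<in> N (vs ! i))"

lemma path_in_snoc:
  assumes "path_in N W vs" "y \<in> N (last vs)" "y \<in> W" "y \<notin> set vs"
  shows "path_in N W (vs @ [y])"
  unfolding path_in_def
proof (intro conjI allI impI)
  fix i assume i: "Suc i < length (vs @ [y])"
  show "(vs @ [y]) ! Suc i \<in> N ((vs @ [y]) ! i)"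
  proof (cases "Suc i < length vs")
    case True
    then show ?thesis using assms(1) by (simp add: path_in_def nth_append)
  next
    case False
    then have "Suc i = length vs" using i by simp
    then have "i = length vs - 1" "i < length vs" by auto
    then show ?thesis using assms(1,2) False by (simp add: path_in_def nth_append last_conv_nth)
  qed
qed (use assms in \<open>auto simp: path_in_def\<close>)

text \<open>On a longest path extending \<open>vs0\<close>, all neighbours in \<open>W\<close> of
  the last vertex lie on the path, and one of two such neighbours is not its predecessor. The prefix
  \<open>vs0\<close> prescribes a first vertex or edge.\<close>

lemma path_in_closes:
  assumes "finite W" and deg: "\<forall>x\<in>W. \<exists>a b. a \<noteq> b \<and> a \<in> N x \<inter> W \<and> b \<in> N x \<inter> W"
    and irrefl: "\<And>v. v \<notin> N v" and vs0: "path_in N W vs0"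
  shows "\<exists>vs j. path_in N W vs \<and> take (length vs0) vs = vs0 \<and> j + 2 < length vs \<and> vs ! j \<in> N (last vs)"
proof -
  let ?P = "\<lambda>vs. path_in N W vs \<and> take (length vs0) vs = vs0"
  have "length vs \<le> card W" if "?P vs" for vs
    using that assms(1) by (metis card_mono distinct_card path_in_def)
  then obtain vs where vs: "?P vs" and max: "\<And>vs'. ?P vs' \<Longrightarrow> length vs' \<le> length vs"
    using ex_has_greatest_nat[of ?P vs0 length "Suc (card W)"] vs0 by (auto simp: less_Suc_eq_le)
  have ne: "vs \<noteq> []" and dist: "distinct vs" and sub: "set vs \<subseteq> W"
    using vs by (auto simp: path_in_def)
  have len: "length vs0 \<le> length vs" using vs by (metis nat_le_linear take_all)
  have on: "y \<in> set vs" if y: "y \<in> N (last vs) \<inter> W" for y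
  proof (rule ccontr)
    assume "y \<notin> set vs"
    then have "?P (vs @ [y])" using path_in_snoc[of N W vs y] vs y len by simp
    then show False using max by fastforce
  qed
  have "last vs \<in> W" using ne sub last_in_set by blast
  then obtain a b where ab: "a \<noteq> b" "a \<in> N (last vs) \<inter> W" "b \<in> N (last vs) \<inter> W" using deg by blast
  obtain j k where jk: "j < length vs" "vs ! j = a" "k < length vs" "vs ! k = b"
    using on[OF ab(2)] on[OF ab(3)] by (auto simp: in_set_conv_nth)
  have "j \<noteq> k" using ab jk by auto
  moreover have "j \<noteq> length vs - 1" "k \<noteq> length vs - 1"
    using jk ab irrefl ne by (auto simp: last_conv_nth)
  ultimately have "j + 2 < length vs \<or> k + 2 < length vs" using jk by linarith
  then show ?thesis using vs jk ab by blast
qed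

lemma path_in_circuit:
  assumes vs: "path_in N W vs" and j: "j + 2 < length vs" "vs ! j \<in> N (last vs)"
    and sym: "\<And>u v. u \<in> N v \<Longrightarrow> v \<in> N u"
  defines "m \<equiv> length vs - j" and "c \<equiv> \<lambda>i. vs ! (j + i mod (length vs - j))"
  shows "circuit N c m" "c ` {0..<m} = set (drop j vs)"
proof -
  have "walk N c m"
    unfolding walk_def
  proof (intro allI impI)
    fix i assume i: "i < m"
    have "c (Suc i) \<in> N (c i)"
    proof (cases "Suc i = m")
      case True
      then have "c (Suc i) = vs ! j" by (simp add: c_def m_def)
      moreover have "c i = vs ! (j + i)" using i by (simp add: c_def m_def)
      moreover have "j + i = length vs - 1" using True by (simp add: m_def)
      ultimately show ?thesis using j vs by (simp add: last_conv_nth path_in_def)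
    next
      case False
      then have "c (Suc i) = vs ! Suc (j + i)" "c i = vs ! (j + i)" "Suc (j + i) < length vs"
        using i by (auto simp: c_def m_def)
      then show ?thesis using vs by (simp add: path_in_def)
    qed
    then show "c (Suc i) \<in> N (c i) \<and> c i \<in> N (c (Suc i))" using sym by blast
  qed
  moreover have "inj_on c {0..<m}"
  proof (rule inj_onI)
    fix x y assume xy: "x \<in> {0..<m}" "y \<in> {0..<m}" "c x = c y"
    then have "vs ! (j + x) = vs ! (j + y)" "j + x < length vs" "j + y < length vs"
      by (auto simp: c_def m_def)
    then show "x = y" using vs by (simp add: path_in_def nth_eq_iff_index_eq)
  qed
  ultimately show "circuit N c m" using j by (simp add: circuit_def m_def c_def)
  have "c ` {0..<m} = (!) (drop j vs) ` {0..<length (drop j vs)}"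
    by (rule image_cong) (auto simp: c_def m_def)
  also have "\<dots> = set (drop j vs)" by (rule image_nth)
  finally show "c ` {0..<m} = set (drop j vs)" .
qed

section \<open>The core of a winning graph\<close>

lemma neighbours_sym: "pair_graph G \<Longrightarrow> u \<in> neighbours G v \<Longrightarrow> v \<in> neighbours G u"
proof -
  assume "pair_graph G"
  then interpret pair_graph G .
  show "u \<in> neighbours G v \<Longrightarrow> v \<in> neighbours G u"
    using arcs_symmetric by (auto simp: neighbours_def)
qed

lemma neighbours_irrefl: "pair_graph G \<Longrightarrow> v \<notin> neighbours G v"
proof -
  assume "pair_graph G"
  then interpret pair_graph G .
  show "v \<notin> neighbours G v"
    using pair_no_loops by (fastforce simp: neighbours_def)
qed

lemma neighbours_pverts: "pair_graph G \<Longrightarrow> neighbours G v \<subseteq> pverts G"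
proof -
  assume "pair_graph G"
  then interpret pair_graph G .
  show "neighbours G v \<subseteq> pverts G" by (auto simp: neighbours_def dest: in_arcsD2)
qed

lemma sages_win_core:
  assumes G: "pair_graph G" and "sages_win G"
  obtains W where "finite W" "W \<noteq> {}" "forces (\<lambda>v. neighbours G v \<inter> W) W (\<lambda>_. False)"
    "\<forall>x\<in>W. \<exists>a b. a \<noteq> b \<and> a \<in> neighbours G x \<inter> W \<and> b \<in> neighbours G x \<inter> W"
proof -
  have fin: "finite (pverts G)" using G by (simp add: pair_graph_def pair_digraph_def pair_fin_digraph_def pair_fin_digraph_axioms_def)
  have eq: "(\<lambda>v. neighbours G v \<inter> pverts G) = neighbours G"
    using neighbours_pverts[OF G] by (simp add: Int_absorb2)
  have "forces (\<lambda>v. neighbours G v \<inter> pverts G) (pverts G) (\<lambda>_. False)"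
    using assms sages_win_iff_forces[OF G] by (simp add: eq)
  from forces_core[OF fin this neighbours_sym[OF G] neighbours_irrefl[OF G]]
  obtain W where W: "W \<subseteq> pverts G" "forces (\<lambda>v. neighbours G v \<inter> W) W (\<lambda>_. False)"
    "\<forall>x\<in>W. \<exists>a b. a \<noteq> b \<and> a \<in> neighbours G x \<inter> W \<and> b \<in> neighbours G x \<inter> W"
    by blast
  moreover have "W \<noteq> {}" using W(2) by (auto simp: forces_def)
  moreover have "finite W" using W(1) fin by (rule finite_subset)
  ultimately show thesis using that by blast
qed

lemma core_circuit:
  assumes G: "pair_graph G" and W: "finite W"
    "\<forall>x\<in>W. \<exists>a b. a \<noteq> b \<and> a \<in> neighbours G x \<inter> W \<and> b \<in> neighbours G x \<inter> W"
    and vs0: "path_in (neighbours G) W vs0"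
  obtains vs j p where "path_in (neighbours G) W vs" "take (length vs0) vs = vs0" "j + 2 < length vs"
    "graph_cycle G p" "\<Union>(cycle_edges p) = set (drop j vs)"
    "\<forall>i. j \<le> i \<longrightarrow> Suc i < length vs \<longrightarrow> {vs ! i, vs ! Suc i} \<in> cycle_edges p"
proof -
  obtain vs j where vs: "path_in (neighbours G) W vs" "take (length vs0) vs = vs0" "j + 2 < length vs"
    "vs ! j \<in> neighbours G (last vs)"
    using path_in_closes[OF W neighbours_irrefl[OF G] vs0] by blast
  define m where "m = length vs - j"
  define c where "c = (\<lambda>i. vs ! (j + i mod (length vs - j)))"
  have c: "circuit (neighbours G) c m" "c ` {0..<m} = set (drop j vs)"
    unfolding m_def c_def using path_in_circuit[OF vs(1,3,4) neighbours_sym[OF G]] by simp_all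
  obtain p where p: "graph_cycle G p" "cycle_edges p = cycle_of c m"
    using circuit_graph_cycle[OF G c(1)] by blast
  have "{vs ! i, vs ! Suc i} \<in> cycle_edges p" if "j \<le> i" "Suc i < length vs" for i
    unfolding p(2) cycle_of_def using that by (intro image_eqI[of _ _ "i - j"]) (auto simp: c_def m_def Suc_diff_le)
  then show thesis using that vs p c Union_cycle_of[OF c(1)] by simp
qed

lemma sages_win_imp_cycle:
  assumes "pair_graph G" "sages_win G"
  shows "\<exists>p. graph_cycle G p"
proof -
  obtain W where W: "finite W" "W \<noteq> {}" "forces (\<lambda>v. neighbours G v \<inter> W) W (\<lambda>_. False)"
    "\<forall>x\<in>W. \<exists>a b. a \<noteq> b \<and> a \<in> neighbours G x \<inter> W \<and> b \<in> neighbours G x \<inter> W"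
    using assms by (rule sages_win_core)
  then obtain w where "w \<in> W" by blast
  then have "path_in (neighbours G) W [w]" by (simp add: path_in_def)
  with assms(1) W(1,4) show ?thesis by (rule core_circuit) (rule exI)
qed

lemma mod_add_left_inj:
  fixes n s i j :: nat
  assumes "(s + i) mod n = (s + j) mod n" "i \<in> {1..n}" "j \<in> {1..n}"
  shows "i = j"
proof -
  have *: "i = j" if "(s + i) mod n = (s + j) mod n" "1 \<le> i" "j \<le> n" "i \<le> j" for i j
  proof -
    have "n dvd (s + j) - (s + i)"
      using mod_eq_dvd_iff_nat[of "s + i" "s + j" n] that by simp
    then have "n dvd j - i" by simp
    moreover have "j - i < n" using that by linarith
    ultimately have "j - i = 0" by (auto dest: dvd_imp_le)
    then show ?thesis using that by simp
  qed
  show ?thesis using *[of i j] *[of j i] assms by fastforce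
qed

lemma unicyclic_dvd:
  assumes G: "pair_graph G" and win: "sages_win G" and p: "graph_cycle G p" and n: "5 \<le> length p"
    and unique: "\<And>q. graph_cycle G q \<Longrightarrow> cycle_edges q = cycle_edges p"
  shows "3 dvd length p"
proof -
  let ?N = "neighbours G"
  define n where "n = length p"
  obtain c where c: "circuit ?N c n" "cycle_of c n = cycle_edges p" "\<And>i. c (i mod n) = c i"
    using graph_cycle_circuit[OF G p] unfolding n_def by blast
  obtain W where W: "finite W" "W \<noteq> {}" "forces (\<lambda>v. ?N v \<inter> W) W (\<lambda>_. False)"
    "\<forall>x\<in>W. \<exists>a b. a \<noteq> b \<and> a \<in> ?N x \<inter> W \<and> b \<in> ?N x \<inter> W"
    using G win by (rule sages_win_core)
  let ?V = "c ` {0..<n}"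
  have V: "\<Union>(cycle_edges p) = ?V" using Union_cycle_of[OF c(1)] c(2) by simp
  \<comment> \<open>A longest path starting with \<open>u\<close>, \<open>t\<close> closes up to the
    only cycle. As this contains the first vertex \<open>u\<close>, it contains the whole path and
    its first edge.\<close>
  have edge: "{u, t} \<in> cycle_edges p" if u: "u \<in> ?V" "u \<in> W" and t: "t \<in> ?N u \<inter> W" for u t
  proof -
    have path: "path_in ?N W [u, t]"
      using u t neighbours_irrefl[OF G] by (auto simp: path_in_def)
    obtain vs j q where vs: "path_in ?N W vs" "take (length [u, t]) vs = [u, t]" "j + 2 < length vs"
      "graph_cycle G q" "\<Union>(cycle_edges q) = set (drop j vs)"
      "\<forall>i. j \<le> i \<longrightarrow> Suc i < length vs \<longrightarrow> {vs ! i, vs ! Suc i} \<in> cycle_edges q"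
      using G W(1,4) path by (rule core_circuit)
    obtain ys where ys: "vs = u # t # ys"
      using vs(2,3) by (cases vs; cases "tl vs") auto
    have "u \<in> set (drop j vs)" using vs(5) unique[OF vs(4)] V u(1) by simp
    then have "j = 0"
      using vs(1) ys by (cases j) (auto simp: path_in_def dest: in_set_dropD)
    then show ?thesis using vs(6)[rule_format, of 0] vs(3) ys unique[OF vs(4)] by simp
  qed
  have VW: "?V = W"
  proof -
    \<comment> \<open>A longest path from any core vertex \<open>w\<close> also ends in the cycle.
      If the cycle began after \<open>w\<close>, the edge entering it would be a cycle edge with an
      end off the cycle.\<close>
    have *: "?V \<subseteq> W \<and> w \<in> ?V" if w: "w \<in> W" for w
    proof -
      have path: "path_in ?N W [w]" using w by (simp add: path_in_def)
      obtain vs j q where vs: "path_in ?N W vs" "take (length [w]) vs = [w]" "j + 2 < length vs"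
        "graph_cycle G q" "\<Union>(cycle_edges q) = set (drop j vs)"
        "\<forall>i. j \<le> i \<longrightarrow> Suc i < length vs \<longrightarrow> {vs ! i, vs ! Suc i} \<in> cycle_edges q"
        using G W(1,4) path by (rule core_circuit)
      have eq: "set (drop j vs) = ?V" using vs(5) unique[OF vs(4)] V by simp
      have sub: "set vs \<subseteq> W" and dist: "distinct vs" using vs(1) by (auto simp: path_in_def)
      have "?V \<subseteq> W" using eq sub set_drop_subset by fast
      moreover have "w \<in> ?V"
      proof (cases j)
        case 0
        moreover have "hd vs = w" "vs \<noteq> []" using vs(2,3) by (cases vs; auto)+
        ultimately show ?thesis using eq by auto
      next
        case (Suc i)
        have "vs ! j \<in> set (drop j vs)" using vs(3) by (metis Cons_nth_drop_Suc add_lessD1 list.set_intros(1))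
        moreover have "vs ! i \<in> ?N (vs ! j)"
          using vs(1,3) Suc neighbours_sym[OF G] by (auto simp: path_in_def)
        moreover have "vs ! i \<in> W" "vs ! j \<in> W" using vs(3) Suc sub by auto
        ultimately have "{vs ! j, vs ! i} \<in> cycle_edges p" using edge eq by auto
        then have "vs ! i \<in> set (drop j vs)" using V eq by blast
        moreover have "vs ! i \<in> set (take j vs)" using Suc vs(3) by (auto simp: in_set_conv_nth)
        ultimately show ?thesis using set_take_disj_set_drop_if_distinct[OF dist, of j j] by auto
      qed
      ultimately show ?thesis by blast
    qed
    then show ?thesis using W(2) by blast
  qed
  have n5: "5 \<le> n" and inj: "inj_on c {0..<n}" using n c(1) by (auto simp: n_def circuit_def)
  \<comment> \<open>\<open>i + n - 1\<close> is the position before \<open>i\<close>, also for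
    \<open>i = 0\<close>.\<close>
  have nbr: "u = c (i + n - 1) \<or> u = c (Suc i)" if u: "u \<in> ?N (c i) \<inter> W" for u i
  proof -
    have "i mod n < n" using n5 by simp
    then have i: "c i \<in> ?V" using c(3)[of i] by (intro image_eqI[of _ _ "i mod n"]) auto
    then have "{c i, u} \<in> cycle_of c n" using edge[of "c i" u] u VW c(2) by simp
    then obtain k where k: "k < n" "{c i, u} = {c k, c (Suc k)}" by (auto simp: cycle_of_def)
    have *: "a mod n = b mod n" if "c a = c b" for a b
      using that c(3)[of a] c(3)[of b] n5 by (intro inj_onD[OF inj]) auto
    from k(2) consider "c i = c k" "u = c (Suc k)" | "c i = c (Suc k)" "u = c k"
      by (auto simp: doubleton_eq_iff)
    then show ?thesis
    proof cases
      case 1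
      then have "Suc i mod n = Suc k mod n" using mod_Suc_eq[of i n] mod_Suc_eq[of k n] *[of i k] by simp
      then show ?thesis using 1(2) c(3)[of "Suc i"] c(3)[of "Suc k"] by simp
    next
      case 2
      then have "(Suc k + (n - 1)) mod n = (i + (n - 1)) mod n" 
        using *[of i "Suc k"] mod_add_left_eq[of i n "n - 1"] mod_add_left_eq[of "Suc k" n "n - 1"] by simp
      moreover have "Suc k + (n - 1) = k + n" "i + (n - 1) = i + n - 1" using n5 by auto
      ultimately have "k mod n = (i + n - 1) mod n" by simp
      then show ?thesis using 2(2) c(3)[of k] c(3)[of "i + n - 1"] by simp
    qed
  qed
  obtain F :: "'a \<Rightarrow> ('a \<Rightarrow> hat) \<Rightarrow> hat" where
    F: "\<forall>v\<in>W. \<forall>C C'. (\<forall>u\<in>?N v \<inter> W. C u = C' u) \<longrightarrow> F v C = F v C'"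
      "\<forall>C. (\<forall>v\<in>W. F v C \<noteq> C v) \<longrightarrow> False"
    using W(3) by (rule forcesE)
  \<comment> \<open>Only the two cycle neighbours are visible within \<open>W\<close>, so all hats
    but the preceding one may be set to \<open>b\<close>.\<close>
  define f where "f i a b = F (c i) (\<lambda>v. if v = c (i + n - 1) then a else b)" for i a b
  have cn: "c (i + n) = c i" for i using c(3)[of "i + n"] c(3)[of i] by simp
  interpret winning_cycle f n
  proof
    show "5 \<le> n" by (rule n5)
    show "f (i + n) = f i" for i
    proof -
      have "c (i + n + n - 1) = c (i + n - 1)"
        using cn[of "i + n - 1"] n5 by (simp add: add.commute)
      then show ?thesis by (simp add: f_def fun_eq_iff cn)
    qed
    fix d :: "nat \<Rightarrow> hat" and s
    assume d: "d n = d 0" "d (Suc n) = d 1"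
    define g where "g i = c (s + i)" for i
    have ginj: "inj_on g {1..n}"
    proof (rule inj_onI)
      fix i j assume ij: "i \<in> {1..n}" "j \<in> {1..n}" "g i = g j"
      then have "(s + i) mod n = (s + j) mod n"
        using c(3)[of "s + i"] c(3)[of "s + j"] n5 by (intro inj_onD[OF inj]) (auto simp: g_def)
      then show "i = j" using ij mod_add_left_inj by blast
    qed
    define C where "C v = d (inv_into {1..n} g v)" for v
    have C1: "C (g i) = d i" if "i \<in> {1..n}" for i
      using inv_into_f_f[OF ginj that] by (simp add: C_def)
    have C0: "C (g 0) = d 0" using C1[of n] d(1) n5 cn[of s] by (simp add: g_def)
    have CS: "C (g (Suc n)) = d (Suc n)" using C1[of 1] d(2) n5 cn[of "Suc s"] by (simp add: g_def)
    obtain v where v: "v \<in> W" "F v C = C v" using F(2) by blast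
    have "\<exists>i\<in>{1..n}. v = g i"
    proof -
      have "card (g ` {1..n}) = card W" 
        using card_image[OF ginj] card_image[OF inj] VW by simp
      moreover have "g ` {1..n} \<subseteq> W"
      proof
        fix x assume "x \<in> g ` {1..n}"
        then obtain i where "x = c (s + i)" by (auto simp: g_def)
        then have "x = c ((s + i) mod n)" using c(3) by simp
        moreover have "(s + i) mod n < n" using n5 by simp
        ultimately show "x \<in> W" using VW by auto
      qed
      ultimately have "g ` {1..n} = W" using W(1) card_subset_eq by blast
      then show ?thesis using v(1) by blast
    qed
    then obtain i where i: "i \<in> {1..n}" "v = g i" by blast
    have prev: "c (s + i + n - 1) = g (i - 1)"
      using cn[of "s + (i - 1)"] i(1) by (simp add: g_def)
    have "f (s + i) (d (i - 1)) (d (Suc i)) = F v C"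
      unfolding f_def i(2) g_def prev
    proof (rule F(1)[rule_format])
      show "c (s + i) \<in> W" using v i by (simp add: g_def)
      fix u assume "u \<in> ?N (c (s + i)) \<inter> W"
      from nbr[OF this] have "u = g (i - 1) \<or> u = g (Suc i)" using prev by (simp add: g_def)
      moreover have "C (g (i - 1)) = d (i - 1)"
      proof (cases "i = 1")
        case False
        then have "i - 1 \<in> {1..n}" using i(1) by auto
        then show ?thesis by (rule C1)
      qed (use C0 in simp)
      moreover have "C (g (Suc i)) = d (Suc i)"
      proof (cases "i = n")
        case False
        then have "Suc i \<in> {1..n}" using i(1) by auto
        then show ?thesis by (rule C1)
      qed (use CS in simp)
      ultimately show "(if u = c (s + (i - 1)) then d (i - 1) else d (Suc i)) = C u"
        by (auto simp: g_def)
    qed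
    then show "\<exists>i\<in>{1..n}. f (s + i) (d (i - 1)) (d (Suc i)) = d i"
      using i v(2) C1 by auto
  qed
  show ?thesis using dvd_length by (simp add: n_def)
qed

section \<open>Graphs with two cycles\<close>

text \<open>Sorts the links by length; the bounds on the sums say that at most one link is a single
  edge.\<close>

lemma forces_theta_links:
  assumes L: "link N t0 k0 u w" "link N t1 k1 u w" "link N t2 k2 u w"
    and D: "t0 ` {1..<k0} \<inter> t1 ` {1..<k1} = {}" "t0 ` {1..<k0} \<inter> t2 ` {1..<k2} = {}"
      "t1 ` {1..<k1} \<inter> t2 ` {1..<k2} = {}"
    and k: "3 \<le> k0 + k1" "3 \<le> k0 + k2" "3 \<le> k1 + k2"
  shows "forces N (t0 ` {0..k0} \<union> t1 ` {0..k1} \<union> t2 ` {0..k2}) (\<lambda>_. False)"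
proof -
  note D' = D[unfolded Int_commute[of "t0 ` {1..<k0}"]] D(3)[unfolded Int_commute[of "t1 ` {1..<k1}"]]
  consider "k0 \<le> k1" "k1 \<le> k2" | "k0 \<le> k2" "k2 \<le> k1" | "k1 \<le> k0" "k0 \<le> k2"
    | "k1 \<le> k2" "k2 \<le> k0" | "k2 \<le> k0" "k0 \<le> k1" | "k2 \<le> k1" "k1 \<le> k0" by linarith
  then show ?thesis
  proof cases
    case 1
    then show ?thesis using k by (intro forces_theta_sorted[OF L D]) auto
  next
    case 2
    then show ?thesis
      using k forces_theta_sorted[OF L(1,3,2) D(2,1) D'(4)] by (simp add: Un_ac)
  next
    case 3
    then show ?thesis
      using k forces_theta_sorted[OF L(2,1,3) D'(1) D(3,2)] by (simp add: Un_ac)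
  next
    case 4
    then show ?thesis
      using k forces_theta_sorted[OF L(2,3,1) D(3) D'(1,2)] by (simp add: Un_ac)
  next
    case 5
    then show ?thesis
      using k forces_theta_sorted[OF L(3,1,2) D'(2,4) D(1)] by (simp add: Un_ac)
  next
    case 6
    then show ?thesis
      using k forces_theta_sorted[OF L(3,2,1) D'(4,2,1)] by (simp add: Un_ac)
  qed
qed

text \<open>A circuit continued periodically over all naturals, so that a shift makes any vertex its
  start.\<close>

definition ring :: "('a \<Rightarrow> 'a set) \<Rightarrow> (nat \<Rightarrow> 'a) \<Rightarrow> nat \<Rightarrow> bool" where
  "ring N c n \<longleftrightarrow> 3 \<le> n \<and> (\<forall>i. c (Suc i) \<in> N (c i) \<and> c i \<in> N (c (Suc i))) \<and>
     (\<forall>i j. c i = c j \<longleftrightarrow> i mod n = j mod n)"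

lemma ring_circuit:
  assumes "ring N c n"
  shows "circuit N c n"
  using assms by (auto simp: ring_def circuit_def walk_def inj_on_def)

lemma circuit_ring:
  assumes "circuit N c n" "\<And>i. c (i mod n) = c i"
  shows "ring N c n"
proof -
  have n: "3 \<le> n" "walk N c n" "inj_on c {0..<n}" using assms(1) by (auto simp: circuit_def)
  have lt: "i mod n < n" for i using n(1) by simp
  have suc: "c (Suc i) = c (Suc (i mod n))" for i
    using assms(2)[of "Suc i"] assms(2)[of "Suc (i mod n)"] mod_Suc_eq[of i n] by simp
  have "c i = c j \<longleftrightarrow> i mod n = j mod n" for i j
  proof
    assume "c i = c j"
    then have "c (i mod n) = c (j mod n)" using assms(2) by simp
    then show "i mod n = j mod n" using lt by (intro inj_onD[OF n(3)]) auto
  next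
    assume "i mod n = j mod n"
    then show "c i = c j" using assms(2)[of i] assms(2)[of j] by simp
  qed
  moreover have "c (Suc i) \<in> N (c i) \<and> c i \<in> N (c (Suc i))" for i
    using walkD[OF n(2) lt[of i]] assms(2)[of i] suc[of i] by simp
  ultimately show ?thesis using n(1) by (simp add: ring_def)
qed

lemma ring_shift:
  assumes "ring N c n"
  shows "ring N (\<lambda>i. c (a + i)) n"
proof -
  have *: "(a + i) mod n = (a + j) mod n \<longleftrightarrow> i mod n = j mod n" if "i \<le> j" for i j
    using mod_eq_dvd_iff_nat[of "a + i" "a + j" n] mod_eq_dvd_iff_nat[of i j n] that
    by (simp, metis)
  have "(a + i) mod n = (a + j) mod n \<longleftrightarrow> i mod n = j mod n" for i j
    using *[of i j] *[of j i] by (cases "i \<le> j") auto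
  then show ?thesis using assms by (simp add: ring_def)
qed

lemma ring_shift_surj:
  assumes "ring N c n"
  obtains j where "c i = c (a + j)"
proof
  have "n \<noteq> 0" using assms by (auto simp: ring_def)
  then have "a + (i + (n - 1) * a) = i + n * a" by (cases n) auto
  then have "(a + (i + (n - 1) * a)) mod n = i mod n" by (simp only: mod_mult_self2)
  then show "c i = c (a + (i + (n - 1) * a))" using assms by (simp add: ring_def)
qed

lemma ring_window:
  assumes "ring N c n"
  shows "inj_on c {a..<a + n}"
proof (rule inj_onI)
  have *: "i = j" if "i mod n = j mod n" "i \<le> j" "j < i + n" for i j :: nat
  proof -
    have "n dvd j - i" using mod_eq_dvd_iff_nat[of i j n] that by simp
    moreover have "j - i < n" using that by linarith
    ultimately have "j - i = 0" by (auto dest: dvd_imp_le)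
    then show ?thesis using that by simp
  qed
  fix i j assume ij: "i \<in> {a..<a + n}" "j \<in> {a..<a + n}" "c i = c j"
  then have "i mod n = j mod n" using assms by (simp add: ring_def)
  then show "i = j" using *[of i j] *[of j i] ij by (cases "i \<le> j") auto
qed

lemma ring_edge:
  assumes "ring N c n"
  shows "{c i, c (Suc i)} \<in> cycle_of c n"
proof -
  have "c i = c (i mod n)" "i mod n < n" using assms by (auto simp: ring_def)
  moreover have "c (Suc i) = c (Suc (i mod n))" using assms by (simp add: ring_def mod_Suc_eq)
  ultimately show ?thesis unfolding cycle_of_def by (intro image_eqI[of _ _ "i mod n"]) auto
qed

text \<open>The new edge lies on a segment of \<open>z\<close> between two consecutive visits to
  \<open>c\<close>. If the segment returns to its start, it forms a figure eight with
  \<open>c\<close>; otherwise it forms a theta graph with the two arcs of \<open>c\<close>.\<close>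

lemma forces_ear:
  assumes c: "ring N c n" and z: "ring N z m" and meet: "range c \<inter> range z \<noteq> {}"
    and new: "{z e, z (Suc e)} \<notin> cycle_of c n"
  shows "forces N (range c \<union> range z) (\<lambda>_. False)"
proof -
  have m: "3 \<le> m" and n: "3 \<le> n" using c z by (auto simp: ring_def)
  define y where "y i = z (e + i)" for i
  have y: "ring N y m" unfolding y_def using z by (rule ring_shift)
  have ym: "y (i + m) = y i" for i using y by (simp add: ring_def)
  \<comment> \<open>With the new edge from \<open>m\<close> to \<open>Suc m\<close>, the visit
    before it is a maximum over \<open>{1..m}\<close> and the visit after it the least index beyond
    \<open>m\<close>.\<close>
  have new': "{y m, y (Suc m)} \<notin> cycle_of c n"
    using new ym[of 0] ym[of 1] by (simp add: y_def)
  obtain x where x: "x \<in> range c" "x \<in> range z" using meet by auto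
  then obtain i0 where "x = z i0" by blast
  with x(1) have i0: "z i0 \<in> range c" by simp
  obtain i where "z i0 = z (e + i)" using ring_shift_surj[OF z] .
  then have i: "y i \<in> range c" using i0 by (simp add: y_def)
  have "\<exists>i\<in>{1..m}. y i \<in> range c"
  proof (cases "i mod m = 0")
    case True
    then have "y i = y m" using y by (simp add: ring_def)
    then show ?thesis using i m by (intro bexI[of _ m]) auto
  next
    case False
    have "y i = y (i mod m)" "i mod m < m" using y by (auto simp: ring_def)
    then show ?thesis using i False by (intro bexI[of _ "i mod m"]) auto
  qed
  then have ne: "{i \<in> {1..m}. y i \<in> range c} \<noteq> {}" by blast
  define a where "a = Max {i \<in> {1..m}. y i \<in> range c}"
  have a: "1 \<le> a" "a \<le> m" "y a \<in> range c" using Max_in[OF _ ne] by (auto simp: a_def)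
  have a_max: "y i \<notin> range c" if "a < i" "i \<le> m" for i
  proof
    assume "y i \<in> range c"
    then have "i \<in> {i \<in> {1..m}. y i \<in> range c}" using that by simp
    then have "i \<le> a" unfolding a_def by (intro Max_ge) auto
    then show False using that by simp
  qed
  define b where "b = (LEAST i. m < i \<and> y i \<in> range c)"
  have ex: "m < a + m \<and> y (a + m) \<in> range c" using a ym by simp
  have b: "m < b" "y b \<in> range c" using LeastI[of "\<lambda>i. m < i \<and> y i \<in> range c", OF ex] unfolding b_def by blast+
  have b_le: "b \<le> a + m" unfolding b_def by (rule Least_le) (rule ex)
  have b_min: "y i \<notin> range c" if "m < i" "i < b" for i
    using not_less_Least[of i "\<lambda>i. m < i \<and> y i \<in> range c"] that unfolding b_def by blast
  define k where "k = b - a"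
  have k: "1 \<le> k" "k \<le> m" "a + k = b" using a b b_le by (auto simp: k_def)
  define t where "t i = y (a + i)" for i
  have t: "ring N t m" unfolding t_def using y by (rule ring_shift)
  have t_in: "t i \<notin> range c" if "i \<in> {1..<k}" for i
    using a_max[of "a + i"] b_min[of "a + i"] that k(3) by (cases "a + i \<le> m") (simp_all add: t_def)
  have t_out: "t ` {1..<k} \<inter> range c = {}" using t_in by blast
  have t_range: "t i \<in> range z" for i by (simp add: t_def y_def)
  obtain \<alpha> where \<alpha>: "t 0 = c \<alpha>" using a(3) by (auto simp: t_def)
  define d where "d i = c (\<alpha> + i)" for i
  have d: "ring N d n" unfolding d_def using c by (rule ring_shift)
  have d_range: "d i \<in> range c" for i by (simp add: d_def)
  show ?thesis
  \<comment> \<open>A segment of full length \<open>m\<close> means that the rings share a single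
    vertex.\<close>
  proof (cases "k = m")
    case True
    have "d ` {1..<n} \<inter> t ` {1..<m} = {}" using t_out d_range True by blast
    moreover have "t 0 = d 0" using \<alpha> by (simp add: d_def)
    ultimately have "forces N (d ` {0..<n} \<union> t ` {0..<m}) (\<lambda>_. False)"
      using forces_figure_eight[OF ring_circuit[OF d] ring_circuit[OF t]] by blast
    then show ?thesis by (rule forces_mono) (use d_range t_range in auto)
  next
    case False
    then have km: "k < m" using k by simp
    have tinj: "inj_on t {0..<m}" using ring_window[OF t, of 0] by simp
    have lt: "link N t k (t 0) (t k)"
      unfolding link_def using t k km
      by (auto simp: ring_def walk_def intro!: inj_on_subset[OF tinj])
    obtain j where "t k = c j" using b(2) k(3) by (auto simp: t_def)
    obtain i where "c j = c (\<alpha> + i)" using ring_shift_surj[OF c] .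
    then have "t k = d i" using \<open>t k = c j\<close> by (simp add: d_def)
    then have "t k = d (i mod n)" using d by (simp add: ring_def)
    moreover define \<beta> where "\<beta> = i mod n"
    ultimately have \<beta>: "t k = d \<beta>" "\<beta> < n" using n by auto
    have t0: "t 0 = d 0" using \<alpha> by (simp add: d_def)
    have "t 0 \<noteq> t k" using inj_onD[OF tinj, of 0 k] km k(1) by auto
    then have "\<beta> \<noteq> 0" using \<beta>(1) t0 by metis
    then have \<beta>1: "1 \<le> \<beta>" by simp
    have dn: "d n = d 0" using d by (simp add: ring_def)
    have dinj: "inj_on d {0..<n}" "inj_on d {1..n}"
      using ring_window[OF d, of 0] ring_window[OF d, of 1] by (simp_all add: atLeastLessThanSuc_atLeastAtMost)
    have l1: "link N d \<beta> (t 0) (t k)"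
      unfolding link_def using d \<beta> \<beta>1 t0
      by (auto simp: ring_def walk_def intro!: inj_on_subset[OF dinj(1)])
    have l2: "link N (\<lambda>i. d (\<beta> + i)) (n - \<beta>) (t k) (t 0)"
      unfolding link_def
    proof (intro conjI)
      show "inj_on (\<lambda>i. d (\<beta> + i)) {0..n - \<beta>}"
      proof (rule inj_onI)
        fix x y assume "x \<in> {0..n - \<beta>}" "y \<in> {0..n - \<beta>}" "d (\<beta> + x) = d (\<beta> + y)"
        then have "\<beta> + x = \<beta> + y" using \<beta>1 \<beta>(2) by (intro inj_onD[OF dinj(2)]) auto
        then show "x = y" by simp
      qed
      show "walk N (\<lambda>i. d (\<beta> + i)) (n - \<beta>)" using d by (simp add: ring_def walk_def)
    qed (use \<beta> t0 dn in auto)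
    let ?s = "\<lambda>i. d (\<beta> + (n - \<beta> - i))"
    have l3: "link N ?s (n - \<beta>) (t 0) (t k)" using link_rev[OF l2] .
    have s_im: "?s ` {1..<n - \<beta>} = (\<lambda>i. d (\<beta> + i)) ` {1..<n - \<beta>}"
      using link_rev_image[of "\<lambda>i. d (\<beta> + i)" "n - \<beta>"] .
    have disj: "d ` {1..<\<beta>} \<inter> ?s ` {1..<n - \<beta>} = {}"
    proof -
      have "d x \<noteq> d (\<beta> + y)" if "x \<in> {1..<\<beta>}" "y \<in> {1..<n - \<beta>}" for x y
      proof
        assume "d x = d (\<beta> + y)"
        moreover have "\<beta> + y < n" "x < n" using that \<beta>(2) by auto
        ultimately have "x = \<beta> + y" by (intro inj_onD[OF dinj(1)]) auto
        then show False using that by simp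
      qed
      then show ?thesis unfolding s_im by blast
    qed
    have disj2: "d ` {1..<\<beta>} \<inter> t ` {1..<k} = {}" "?s ` {1..<n - \<beta>} \<inter> t ` {1..<k} = {}"
      using t_out d_range by blast+
    \<comment> \<open>A segment of one edge is the new edge, which is not on \<open>c\<close>; so
      neither arc of \<open>c\<close> is a single edge.\<close>
    have k1: "\<beta> \<noteq> 1 \<and> n - \<beta> \<noteq> 1" if "k = 1"
    proof -
      have "a = m" "b = Suc m" using that k a b by auto
      then have "{t 0, t k} \<notin> cycle_of c n" using new' that by (simp add: t_def)
      moreover have "{t 0, t k} \<in> cycle_of c n" if "\<beta> = 1"
        using ring_edge[OF c, of \<alpha>] that \<beta>(1) \<alpha> by (simp add: d_def)
      moreover have "{t 0, t k} \<in> cycle_of c n" if "n - \<beta> = 1"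
      proof -
        have "Suc (\<alpha> + \<beta>) = \<alpha> + n" using that by simp
        then have "c (Suc (\<alpha> + \<beta>)) = d n" by (simp only: d_def)
        then have "c (Suc (\<alpha> + \<beta>)) = t 0" using dn t0 by simp
        then show ?thesis using ring_edge[OF c, of "\<alpha> + \<beta>"] \<beta>(1) by (simp add: d_def insert_commute)
      qed
      ultimately show ?thesis by blast
    qed
    have "k = 1 \<longrightarrow> \<beta> \<noteq> 1 \<and> n - \<beta> \<noteq> 1" using k1 by blast
    then have "3 \<le> \<beta> + (n - \<beta>)" "3 \<le> \<beta> + k" "3 \<le> (n - \<beta>) + k"
      using n \<beta>1 \<beta>(2) k(1) by arith+
    with l1 l3 lt disj disj2
    have "forces N (d ` {0..\<beta>} \<union> ?s ` {0..n - \<beta>} \<union> t ` {0..k}) (\<lambda>_. False)"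
      by (rule forces_theta_links)
    then show ?thesis by (rule forces_mono) (use d_range t_range in auto)
  qed
qed

text \<open>A shortest connection between the circuits repeats no vertex and meets them only at its
  ends, which gives a dumbbell.\<close>

lemma forces_bridge:
  fixes R :: "'a rel"
  defines "N \<equiv> \<lambda>v. {u. (v, u) \<in> R}"
  assumes c: "ring N c n" and z: "ring N z m" and disj: "range c \<inter> range z = {}"
    and sym: "sym R" and conn: "(c 0, z 0) \<in> R\<^sup>*"
    and sub: "range c \<union> range z \<subseteq> V" "R \<subseteq> V \<times> V"
  shows "forces N V (\<lambda>_. False)"
proof -
  let ?P = "\<lambda>k. \<exists>x\<in>range c. \<exists>y\<in>range z. (x, y) \<in> R ^^ k"
  obtain k0 where "?P k0" using rtrancl_imp_relpow[OF conn] by blast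
  define k where "k = (LEAST k. ?P k)"
  have "?P k" unfolding k_def using \<open>?P k0\<close> by (rule LeastI)
  then obtain x y where xy: "x \<in> range c" "y \<in> range z" "(x, y) \<in> R ^^ k" by blast
  have min: "\<not> ?P j" if "j < k" for j using not_less_Least that unfolding k_def by blast
  obtain s where s: "s 0 = x" "s k = y" "\<And>i. i < k \<Longrightarrow> (s i, s (Suc i)) \<in> R"
    using xy(3) unfolding relpow_fun_conv by blast
  have seg: "(s i, s (i + j)) \<in> R ^^ j" if "i + j \<le> k" for i j
    using that
  proof (induction j)
    case (Suc j)
    then have "(s (i + j), s (Suc (i + j))) \<in> R" "(s i, s (i + j)) \<in> R ^^ j" using s(3) by auto
    then show ?case by auto
  qed simp
  have k1: "1 \<le> k"
  proof (rule ccontr)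
    assume "\<not> 1 \<le> k"
    then have "k = 0" by simp
    then have "x = y" using xy(3) by simp
    then show False using xy disj by blast
  qed
  have s_c: "s i \<notin> range c" if "0 < i" "i \<le> k" for i
    using min[of "k - i"] seg[of i "k - i"] that xy(2) s(2) by auto
  have s_z: "s i \<notin> range z" if "i < k" for i
    using min[of i] seg[of 0 i] that xy(1) s(1) by auto
  have inj: "s i \<noteq> s j" if "i < j" "j \<le> k" for i j
  proof
    assume "s i = s j"
    then have "(x, y) \<in> R ^^ (i + (k - j))"
      using relpow_trans[of "s 0" "s i" i R "s k" "k - j"] seg[of 0 i] seg[of j "k - j"] that s(1,2) by simp
    moreover have "i + (k - j) < k" using that by simp
    ultimately show False using min xy by blast
  qed
  then have "inj_on s {0..k}" by (intro inj_onI) (metis atLeastAtMost_iff linorder_neqE_nat)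
  moreover have "walk N s k" using s(3) sym by (auto simp: walk_def N_def dest: symD)
  moreover obtain a where a: "x = c a" using xy(1) by blast
  moreover obtain b where b: "y = z b" using xy(2) by blast
  moreover define c' where "c' i = c (a + i)" for i
  moreover define z' where "z' i = z (b + i)" for i
  moreover have c': "ring N c' n" "ring N z' m" unfolding c'_def z'_def using c z by (simp_all add: ring_shift)
  moreover have r: "c' ` {0..<n} \<subseteq> range c" "z' ` {0..<m} \<subseteq> range z" by (auto simp: c'_def z'_def)
  moreover have "s ` {1..<k} \<inter> (c' ` {0..<n} \<union> z' ` {0..<m}) = {}"
  proof -
    have "s i \<notin> c' ` {0..<n} \<union> z' ` {0..<m}" if "i \<in> {1..<k}" for i
      using s_c[of i] s_z[of i] that r by auto
    then show ?thesis by blast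
  qed
  moreover have "c' ` {0..<n} \<inter> z' ` {0..<m} = {}" using r disj by blast
  ultimately have "forces N (c' ` {0..<n} \<union> z' ` {0..<m} \<union> s ` {1..<k}) (\<lambda>_. False)"
    using s(1,2) k1 by (intro forces_dumbbell ring_circuit) simp_all
  then show ?thesis
  proof (rule forces_mono)
    have "s i \<in> V" if "i < k" for i using s(3)[OF that] sub(2) by auto
    then show "c' ` {0..<n} \<union> z' ` {0..<m} \<union> s ` {1..<k} \<subseteq> V"
      using sub(1) by (intro Un_least subset_trans[OF r(1)] subset_trans[OF r(2)]) auto
  qed
qed

section \<open>From graph cycles to winning strategies\<close>

lemma graph_cycle_ring:
  assumes G: "pair_graph G" and p: "graph_cycle G p"
  obtains c where "ring (neighbours G) c (length p)" "cycle_of c (length p) = cycle_edges p"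
    "range c \<subseteq> pverts G"
proof -
  obtain c where c: "circuit (neighbours G) c (length p)" "cycle_of c (length p) = cycle_edges p"
    "\<And>i. c (i mod length p) = c i"
    using graph_cycle_circuit[OF G p] by blast
  have r: "ring (neighbours G) c (length p)" using c(1,3) by (rule circuit_ring)
  then have "c i \<in> pverts G" for i
    using neighbours_pverts[OF G, of "c (Suc i)"] by (auto simp: ring_def)
  then show thesis using that[OF r c(2)] by blast
qed

lemma sages_winI:
  assumes "pair_graph G" "forces (neighbours G) D (\<lambda>_. False)" "D \<subseteq> pverts G"
  shows "sages_win G"
  using forces_mono[OF assms(2,3)] sages_win_iff_forces[OF assms(1)] by simp

lemma winning_length_win:
  assumes G: "pair_graph G" and p: "graph_cycle G p" "winning_length (length p)"
  shows "sages_win G"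
proof -
  obtain c where c: "ring (neighbours G) c (length p)" "cycle_of c (length p) = cycle_edges p"
    "range c \<subseteq> pverts G"
    using G p(1) by (rule graph_cycle_ring)
  show ?thesis
    using G forces_circuit[OF ring_circuit[OF c(1)] p(2)] by (rule sages_winI) (use c(3) in auto)
qed

lemma two_cycles_win:
  assumes G: "pair_graph G" and conn: "Digraph_Component.connected (with_proj G)"
    and p: "graph_cycle G p" and q: "graph_cycle G q" and ne: "\<not> cycle_edges q \<subseteq> cycle_edges p"
  shows "sages_win G"
proof -
  interpret pair_graph G by fact
  obtain c where c: "ring (neighbours G) c (length p)" "cycle_of c (length p) = cycle_edges p"
    "range c \<subseteq> pverts G"
    using G p by (rule graph_cycle_ring)
  obtain z where z: "ring (neighbours G) z (length q)" "cycle_of z (length q) = cycle_edges q"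
    "range z \<subseteq> pverts G"
    using G q by (rule graph_cycle_ring)
  show ?thesis
  proof (cases "range c \<inter> range z = {}")
    case True
    have N: "neighbours G = (\<lambda>v. {u. (v, u) \<in> parcs G})" by (simp add: neighbours_def fun_eq_iff)
    have "reachable (with_proj (mk_symmetric (with_proj G))) (c 0) (z 0)"
      using conn c(3) z(3) by (auto simp: Digraph_Component.connected_def strongly_connected_def)
    then have "(c 0, z 0) \<in> (parcs (mk_symmetric (with_proj G)))\<^sup>*"
      unfolding reachable_def by (auto dest: rtrancl_on_rtranclI)
    \<comment> \<open>Symmetric arcs are their own symmetric closure, so connectedness gives
      reachability in \<open>G\<close> itself.\<close>
    moreover have "parcs (mk_symmetric (with_proj G)) = parcs G"
      using arcs_symmetric by (auto simp: parcs_mk_symmetric)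
    ultimately have "(c 0, z 0) \<in> (parcs G)\<^sup>*" by simp
    moreover have "sym (parcs G)" using arcs_symmetric by (auto intro: symI)
    moreover have "parcs G \<subseteq> pverts G \<times> pverts G" by (auto dest: in_arcsD1 in_arcsD2)
    ultimately have "forces (neighbours G) (pverts G) (\<lambda>_. False)"
      unfolding N using True c z by (intro forces_bridge[where c = c and z = z]) (auto simp flip: N)
    then show ?thesis using G sages_winI by blast
  next
    case False
    obtain E where E: "E \<in> cycle_of z (length q)" "E \<notin> cycle_of c (length p)"
      using ne c(2) z(2) by blast
    then obtain e where "{z e, z (Suc e)} \<notin> cycle_of c (length p)"
      unfolding cycle_of_def[of z] by blast
    with c(1) z(1) False have "forces (neighbours G) (range c \<union> range z) (\<lambda>_. False)"
      by (rule forces_ear)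
    then show ?thesis using G c(3) z(3) sages_winI by blast
  qed
qed

theorem theorem20:
  fixes G :: "'a pair_pre_digraph"
  assumes "pair_graph G"
    and "Digraph_Component.connected (with_proj G)"
  shows "sages_lose G \<longleftrightarrow>
    graph_tree G \<or> (\<exists>n. has_unique_cycle_of_length G n \<and> 5 \<le> n \<and> \<not> 3 dvd n)"
proof
  assume lose: "sages_lose G"
  show "graph_tree G \<or> (\<exists>n. has_unique_cycle_of_length G n \<and> 5 \<le> n \<and> \<not> 3 dvd n)"
  proof (cases "\<exists>p. graph_cycle G p")
    case False
    then show ?thesis using assms(2) by (simp add: graph_tree_def)
  next
    case True
    then obtain p where p: "graph_cycle G p" by blast
    \<comment> \<open>Exchanging the two cycles gives both inclusions.\<close>
    have "cycle_edges q = cycle_edges p" if "graph_cycle G q" for q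
      using two_cycles_win[OF assms p that] two_cycles_win[OF assms that p] lose by blast
    then have "has_unique_cycle_of_length G (length p)"
      using p unfolding has_unique_cycle_of_length_def by blast
    moreover have nd: "\<not> 3 dvd length p" and "length p \<noteq> 4"
      using winning_length_win[OF assms(1) p] lose by (auto simp: winning_length_def)
    moreover have "3 \<le> length p" using p by (simp add: graph_cycle_def)
    moreover have "length p \<noteq> 3" using nd by auto
    ultimately show ?thesis by (intro disjI2 exI[of _ "length p"]) linarith
  qed
next
  assume "graph_tree G \<or> (\<exists>n. has_unique_cycle_of_length G n \<and> 5 \<le> n \<and> \<not> 3 dvd n)"
  then show "sages_lose G"
  proof
    assume "graph_tree G"
    then show ?thesis using sages_win_imp_cycle[OF assms(1)] by (auto simp: graph_tree_def)
  next
    assume "\<exists>n. has_unique_cycle_of_length G n \<and> 5 \<le> n \<and> \<not> 3 dvd n"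
    then obtain p where "graph_cycle G p" "5 \<le> length p" "\<not> 3 dvd length p"
      "\<And>q. graph_cycle G q \<Longrightarrow> cycle_edges q = cycle_edges p"
      unfolding has_unique_cycle_of_length_def by blast
    then show ?thesis using unicyclic_dvd[OF assms(1)] by blast
  qed
qed

end
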